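(* For $1\le i\le n$ let $N_i$ be a positive integer, let $N=N_1\cdots N_n$, and let $a_{i1},\dots,a_{iN_i}$ be non-zero complex numbers with $a_{ij}^{m_i}\neq a_{ij'}^{m_i}$ for $j\ne j'$. Let $I_1,\dots,I_N$ be an enumeration of the multi-indices $(i_1,\dots,i_n)$ with $1\le i_j\le N_j$, and for $q\in\mathbb Z^n$ and a multi-index $\iota=(i_1,\dots,i_n)$ put $a_\iota^q=a_{1i_1}^{q_1}\cdots a_{ni_n}^{q_n}$. Let $\varphi:\mathfrak L'\to\bigoplus_{N\text{ copies}}\mathfrak L(\mathfrak g,\sigma_0)$ be the Lie algebra homomorphism given by $$\varphi(Xt_0^{k_0}t^k)=(Xt^{k_0}a_{I_1}^k,\dots,Xt^{k_0}a_{I_N}^k)\quad (X\in\mathfrak g(\bar k_0,\bar k)),\qquad \varphi(K\otimes t^k)=(Ka_{I_1}^k,\dots,Ka_{I_N}^k)\quad(k\in\Gamma).$$ Let $I'$ be the ideal of $A(m)$ generated by $P_i'(t_i^{m_i})=\prod_{j=1}^{N_i}(t_i^{m_i}-a_{ij}^{m_i})$, $1\le i\le n$. Then: (1) $\varphi$ is surjective; (2) $\mathfrak L'/\mathfrak L'(I')\cong\bigoplus_{N\text{ copies}}\mathfrak L(\mathfrak g,\sigma_0)$; (3) $\varphi$ preserves the $d_0$-grading.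
   Context: Everything is over $\mathbb{C}$. Let $\mathfrak g$ be a finite dimensional simple Lie algebra with a non-degenerate symmetric invariant bilinear form $(\cdot|\cdot)$. Let $n\ge 1$ and let $\sigma_0,\dots,\sigma_n$ be commuting automorphisms of $\mathfrak g$ of finite orders $m_0,\dots,m_n$; let $\xi_i$ be a primitive $m_i$-th root of unity. For $(k_0,k)\in\mathbb Z\times\mathbb Z^n$ put $\mathfrak g(\bar k_0,\bar k)=\{X\in\mathfrak g:\sigma_iX=\xi_i^{k_i}X,\ 0\le i\le n\}$ (depending only on $k_i$ mod $m_i$), and $\mathfrak g_{\bar k_0}=\{X\in\mathfrak g:\sigma_0X=\xi_0^{k_0}X\}$. Write $t^k=t_1^{k_1}\cdots t_n^{k_n}$, $\Gamma=m_1\mathbb Z\oplus\cdots\oplus m_n\mathbb Z$, $A(m)=\mathbb C[t_1^{\pm m_1},\dots,t_n^{\pm m_n}]$. Standing assumption: $LT=\bigoplus_{(k_0,k)\in\mathbb Z^{n+1}}\mathfrak g(\bar k_0,\bar k)t_0^{k_0}t^k$ is a Lie torus, meaning: (1) $\mathfrak g(\bar0,\bar0)$ is a simple Lie algebra; (2) as a $\mathfrak g(\bar0,\bar0)$-module each $\mathfrak g(\bar k_0,\bar k)=U(\bar k_0,\bar k)\oplus V(\bar k_0,\bar k)$ with $U$ trivial and $V$ either zero or irreducible with highest weight equal to the highest root, or the highest short root if the root system of $\mathfrak g(\bar 0,\bar 0)$ is not simply laced, or twice the highest short root if it is of type $B_l$. The Lie algebra $\mathfrak L'=\bigoplus_{(k_0,k)\in\mathbb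 Z^{n+1}}\mathfrak g(\bar k_0,\bar k)t_0^{k_0}t^k\oplus (K\otimes A(m))$ has brackets, for $X\in\mathfrak g(\bar k_0,\bar k)$, $Y\in\mathfrak g(\bar l_0,\bar l)$: $[Xt_0^{k_0}t^k,Yt_0^{l_0}t^l]=[X,Y]t_0^{k_0+l_0}t^{k+l}+(X|Y)\delta_{k_0+l_0,0}k_0K\otimes t^{k+l}$ (note $(X|Y)\ne0$ forces $k+l\in\Gamma$), with $K\otimes A(m)$ central. For an ideal $J$ of $A(m)$, $\mathfrak L'(J)=\sum_{(k_0,k)}\mathfrak g(\bar k_0,\bar k)t_0^{k_0}t^kJ+K\otimes J$, an ideal of $\mathfrak L'$. $\mathfrak L(\mathfrak g,\sigma_0)=\bigoplus_{k_0\in\mathbb Z}\mathfrak g_{\bar k_0}\otimes t^{k_0}\oplus\mathbb CK$ with $K$ central and $[Xt^{a},Yt^{b}]=[X,Y]t^{a+b}+(X|Y)\delta_{a+b,0}\,a\,K$ (an affine Lie algebra). The $d_0$-grading: $Xt_0^{k_0}t^k\in\mathfrak L'$ and $Xt^{k_0}\in\mathfrak L(\mathfrak g,\sigma_0)$ have degree $k_0$, and $K\otimes A(m)$, $K$ have degree $0$. *)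

theory Defs
  imports "HOL-Analysis.Analysis" "HOL-Library.Poly_Mapping"
begin

section \<open>Lie algebras over the complex numbers\<close>

locale complex_lie_algebra = vector_space sc
  for sc :: "complex \<Rightarrow> 'g::ab_group_add \<Rightarrow> 'g" +
  fixes br :: "'g \<Rightarrow> 'g \<Rightarrow> 'g"
  assumes linear_right: "Vector_Spaces.linear sc sc (br x)"
    and linear_left: "Vector_Spaces.linear sc sc (\<lambda>x. br x y)"
    and alternating: "br x x = 0"
    and jacobi: "br x (br y z) + br y (br z x) + br z (br x y) = 0"

definition finite_dim :: "(complex \<Rightarrow> 'g::ab_group_add \<Rightarrow> 'g) \<Rightarrow> bool" where
  "finite_dim sc \<longleftrightarrow> (\<exists>B. finite B \<and> module.span sc B = UNIV)"

definition lie_subalgebra ::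
  "(complex \<Rightarrow> 'g::ab_group_add \<Rightarrow> 'g) \<Rightarrow> ('g \<Rightarrow> 'g \<Rightarrow> 'g) \<Rightarrow> 'g set \<Rightarrow> bool" where
  "lie_subalgebra sc br S \<longleftrightarrow> module.subspace sc S \<and> (\<forall>x\<in>S. \<forall>y\<in>S. br x y \<in> S)"

definition lie_submodule ::
  "(complex \<Rightarrow> 'g::ab_group_add \<Rightarrow> 'g) \<Rightarrow> ('g \<Rightarrow> 'g \<Rightarrow> 'g) \<Rightarrow> 'g set \<Rightarrow> 'g set \<Rightarrow> bool" where
  "lie_submodule sc br S W \<longleftrightarrow> module.subspace sc W \<and> (\<forall>x\<in>S. \<forall>w\<in>W. br x w \<in> W)"

definition irreducible_submodule ::
  "(complex \<Rightarrow> 'g::ab_group_add \<Rightarrow> 'g) \<Rightarrow> ('g \<Rightarrow> 'g \<Rightarrow> 'g) \<Rightarrow> 'g set \<Rightarrow> 'g set \<Rightarrow> bool" where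
  "irreducible_submodule sc br S V \<longleftrightarrow>
     lie_submodule sc br S V \<and> V \<noteq> {0} \<and>
     (\<forall>W. lie_submodule sc br S W \<and> W \<subseteq> V \<longrightarrow> W = {0} \<or> W = V)"

definition simple_lie ::
  "(complex \<Rightarrow> 'g::ab_group_add \<Rightarrow> 'g) \<Rightarrow> ('g \<Rightarrow> 'g \<Rightarrow> 'g) \<Rightarrow> 'g set \<Rightarrow> bool" where
  "simple_lie sc br S \<longleftrightarrow>
     lie_subalgebra sc br S \<and> (\<exists>x\<in>S. \<exists>y\<in>S. br x y \<noteq> 0) \<and>
     (\<forall>J. lie_submodule sc br S J \<and> J \<subseteq> S \<longrightarrow> J = {0} \<or> J = S)"

definition lie_automorphism ::
  "(complex \<Rightarrow> 'g::ab_group_add \<Rightarrow> 'g) \<Rightarrow> ('g \<Rightarrow> 'g \<Rightarrow> 'g) \<Rightarrow> ('g \<Rightarrow> 'g) \<Rightarrow> bool" where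
  "lie_automorphism sc br \<sigma> \<longleftrightarrow>
     Vector_Spaces.linear sc sc \<sigma> \<and> bij \<sigma> \<and> (\<forall>x y. \<sigma> (br x y) = br (\<sigma> x) (\<sigma> y))"

definition invariant_form ::
  "(complex \<Rightarrow> 'g::ab_group_add \<Rightarrow> 'g) \<Rightarrow> ('g \<Rightarrow> 'g \<Rightarrow> 'g) \<Rightarrow> ('g \<Rightarrow> 'g \<Rightarrow> complex) \<Rightarrow> bool" where
  "invariant_form sc br B \<longleftrightarrow>
     (\<forall>x. Vector_Spaces.linear sc (*) (B x)) \<and>
     (\<forall>x y. B x y = B y x) \<and>
     (\<forall>x y z. B (br x y) z = B x (br y z))"

definition nondegenerate :: "('g::zero \<Rightarrow> 'g \<Rightarrow> complex) \<Rightarrow> bool" where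
  "nondegenerate B \<longleftrightarrow> (\<forall>x. (\<forall>y. B x y = 0) \<longrightarrow> x = 0)"

definition has_order :: "('g \<Rightarrow> 'g) \<Rightarrow> nat \<Rightarrow> bool" where
  "has_order \<sigma> m \<longleftrightarrow> 0 < m \<and> \<sigma> ^^ m = id \<and> (\<forall>j. 0 < j \<and> j < m \<longrightarrow> \<sigma> ^^ j \<noteq> id)"

definition primitive_root :: "nat \<Rightarrow> complex \<Rightarrow> bool" where
  "primitive_root m z \<longleftrightarrow> 0 < m \<and> z ^ m = 1 \<and> (\<forall>j. 0 < j \<and> j < m \<longrightarrow> z ^ j \<noteq> 1)"


section \<open>Root data of a simple Lie algebra\<close>

text \<open>Throughout, \<open>S\<close> is a (simple) subalgebra of the ambient Lie algebra, \<open>H\<close> a Cartan subalgebra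
  of \<open>S\<close> (toral and equal to its own centralizer) and \<open>R\<close> a base of the root system.\<close>

definition cartan_subalgebra ::
  "(complex \<Rightarrow> 'g::ab_group_add \<Rightarrow> 'g) \<Rightarrow> ('g \<Rightarrow> 'g \<Rightarrow> 'g) \<Rightarrow> 'g set \<Rightarrow> 'g set \<Rightarrow> bool" where
  "cartan_subalgebra sc br S H \<longleftrightarrow>
     H \<subseteq> S \<and> module.subspace sc H \<and>
     (\<forall>h\<in>H. S \<subseteq> module.span sc {x \<in> S. \<exists>c. br h x = sc c x}) \<and>
     {x \<in> S. \<forall>h\<in>H. br h x = 0} = H"

definition weight_space ::
  "(complex \<Rightarrow> 'g::ab_group_add \<Rightarrow> 'g) \<Rightarrow> ('g \<Rightarrow> 'g \<Rightarrow> 'g) \<Rightarrow> 'g set \<Rightarrow> 'g set \<Rightarrow> ('g \<Rightarrow> complex) \<Rightarrow> 'g set"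
  where "weight_space sc br S H \<alpha> = {x \<in> S. \<forall>h\<in>H. br h x = sc (\<alpha> h) x}"

text \<open>A functional on \<open>H\<close> is represented by its extension by zero to the whole type, so that
  functionals are equal as functions iff they agree on \<open>H\<close>. Linearity of a root on \<open>H\<close> follows from
  the existence of a root vector.\<close>

definition roots ::
  "(complex \<Rightarrow> 'g::ab_group_add \<Rightarrow> 'g) \<Rightarrow> ('g \<Rightarrow> 'g \<Rightarrow> 'g) \<Rightarrow> 'g set \<Rightarrow> 'g set \<Rightarrow> ('g \<Rightarrow> complex) set" where
  "roots sc br S H =
     {\<alpha>. (\<forall>x. x \<notin> H \<longrightarrow> \<alpha> x = 0) \<and> \<alpha> \<noteq> (\<lambda>_. 0) \<and> weight_space sc br S H \<alpha> \<noteq> {0}}"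

definition nonneg_comb :: "('g \<Rightarrow> complex) set \<Rightarrow> ('g \<Rightarrow> complex) \<Rightarrow> bool" where
  "nonneg_comb R \<alpha> \<longleftrightarrow> (\<exists>c. \<alpha> = (\<lambda>h. \<Sum>\<beta>\<in>R. of_nat (c \<beta>) * \<beta> h))"

definition root_base ::
  "(complex \<Rightarrow> 'g::ab_group_add \<Rightarrow> 'g) \<Rightarrow> ('g \<Rightarrow> 'g \<Rightarrow> 'g) \<Rightarrow> 'g set \<Rightarrow> 'g set \<Rightarrow> ('g \<Rightarrow> complex) set \<Rightarrow> bool" where
  "root_base sc br S H R \<longleftrightarrow>
     finite R \<and> R \<subseteq> roots sc br S H \<and>
     (\<forall>c. (\<forall>h. (\<Sum>\<beta>\<in>R. c \<beta> * \<beta> h) = 0) \<longrightarrow> (\<forall>\<beta>\<in>R. c \<beta> = 0)) \<and>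
     (\<forall>\<alpha>\<in>roots sc br S H. nonneg_comb R \<alpha> \<or> nonneg_comb R (\<lambda>h. - \<alpha> h))"

definition trace_on ::
  "(complex \<Rightarrow> 'g::ab_group_add \<Rightarrow> 'g) \<Rightarrow> 'g set \<Rightarrow> ('g \<Rightarrow> 'g) \<Rightarrow> complex" where
  "trace_on sc S T =
     (let B = SOME B. \<not> module.dependent sc B \<and> module.span sc B = S
      in \<Sum>b\<in>B. module.representation sc B (T b) b)"

definition killing_form ::
  "(complex \<Rightarrow> 'g::ab_group_add \<Rightarrow> 'g) \<Rightarrow> ('g \<Rightarrow> 'g \<Rightarrow> 'g) \<Rightarrow> 'g set \<Rightarrow> 'g \<Rightarrow> 'g \<Rightarrow> complex" where
  "killing_form sc br S x y = trace_on sc S (\<lambda>z. br x (br y z))"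

text \<open>The element \<open>t\<^sub>\<alpha>\<close> of \<open>H\<close> representing \<open>\<alpha>\<close> with respect to the Killing form of \<open>S\<close>, and the
  induced form on the roots.\<close>

definition dual_elt ::
  "(complex \<Rightarrow> 'g::ab_group_add \<Rightarrow> 'g) \<Rightarrow> ('g \<Rightarrow> 'g \<Rightarrow> 'g) \<Rightarrow> 'g set \<Rightarrow> 'g set \<Rightarrow> ('g \<Rightarrow> complex) \<Rightarrow> 'g" where
  "dual_elt sc br S H \<alpha> = (THE t. t \<in> H \<and> (\<forall>h\<in>H. killing_form sc br S t h = \<alpha> h))"

definition root_ip ::
  "(complex \<Rightarrow> 'g::ab_group_add \<Rightarrow> 'g) \<Rightarrow> ('g \<Rightarrow> 'g \<Rightarrow> 'g) \<Rightarrow> 'g set \<Rightarrow> 'g set \<Rightarrow>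
     ('g \<Rightarrow> complex) \<Rightarrow> ('g \<Rightarrow> complex) \<Rightarrow> complex" where
  "root_ip sc br S H \<alpha> \<beta> =
     killing_form sc br S (dual_elt sc br S H \<alpha>) (dual_elt sc br S H \<beta>)"

definition cartan_integer ::
  "(complex \<Rightarrow> 'g::ab_group_add \<Rightarrow> 'g) \<Rightarrow> ('g \<Rightarrow> 'g \<Rightarrow> 'g) \<Rightarrow> 'g set \<Rightarrow> 'g set \<Rightarrow>
     ('g \<Rightarrow> complex) \<Rightarrow> ('g \<Rightarrow> complex) \<Rightarrow> complex" where
  "cartan_integer sc br S H \<alpha> \<beta> = 2 * root_ip sc br S H \<alpha> \<beta> / root_ip sc br S H \<beta> \<beta>"

text \<open>The squared length of a root is a positive real number.\<close>

definition root_length_sq ::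
  "(complex \<Rightarrow> 'g::ab_group_add \<Rightarrow> 'g) \<Rightarrow> ('g \<Rightarrow> 'g \<Rightarrow> 'g) \<Rightarrow> 'g set \<Rightarrow> 'g set \<Rightarrow> ('g \<Rightarrow> complex) \<Rightarrow> real" where
  "root_length_sq sc br S H \<alpha> = Re (root_ip sc br S H \<alpha> \<alpha>)"

definition simply_laced ::
  "(complex \<Rightarrow> 'g::ab_group_add \<Rightarrow> 'g) \<Rightarrow> ('g \<Rightarrow> 'g \<Rightarrow> 'g) \<Rightarrow> 'g set \<Rightarrow> 'g set \<Rightarrow> bool" where
  "simply_laced sc br S H \<longleftrightarrow>
     (\<forall>\<alpha>\<in>roots sc br S H. \<forall>\<beta>\<in>roots sc br S H.
        root_length_sq sc br S H \<alpha> = root_length_sq sc br S H \<beta>)"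

definition short_roots ::
  "(complex \<Rightarrow> 'g::ab_group_add \<Rightarrow> 'g) \<Rightarrow> ('g \<Rightarrow> 'g \<Rightarrow> 'g) \<Rightarrow> 'g set \<Rightarrow> 'g set \<Rightarrow> ('g \<Rightarrow> complex) set" where
  "short_roots sc br S H =
     {\<alpha> \<in> roots sc br S H. \<forall>\<beta>\<in>roots sc br S H.
        root_length_sq sc br S H \<alpha> \<le> root_length_sq sc br S H \<beta>}"

definition highest_in :: "('g \<Rightarrow> complex) set \<Rightarrow> ('g \<Rightarrow> complex) set \<Rightarrow> ('g \<Rightarrow> complex) \<Rightarrow> bool" where
  "highest_in R D \<theta> \<longleftrightarrow> \<theta> \<in> D \<and> (\<forall>\<beta>\<in>D. nonneg_comb R (\<lambda>h. \<theta> h - \<beta> h))"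

text \<open>Type \<open>B\<^sub>l\<close> with \<open>l \<ge> 1\<close>, via the Cartan matrix in the numbering whose last simple root is the
  short one. The case \<open>l = 1\<close> is \<open>B\<^sub>1 = A\<^sub>1\<close>, whose two roots both count as short roots.\<close>

definition type_B ::
  "(complex \<Rightarrow> 'g::ab_group_add \<Rightarrow> 'g) \<Rightarrow> ('g \<Rightarrow> 'g \<Rightarrow> 'g) \<Rightarrow> 'g set \<Rightarrow> 'g set \<Rightarrow> ('g \<Rightarrow> complex) set \<Rightarrow> bool" where
  "type_B sc br S H R \<longleftrightarrow>
     (\<exists>l::nat. \<exists>e. 1 \<le> l \<and> bij_betw e {1..l} R \<and>
        (\<forall>i\<in>{1..l}. \<forall>j\<in>{1..l}. cartan_integer sc br S H (e i) (e j) =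
           (if i = j then 2
            else if j = i + 1 \<and> j = l then - 2
            else if j = i + 1 \<or> i = j + 1 then - 1
            else 0)))"

definition has_highest_weight ::
  "(complex \<Rightarrow> 'g::ab_group_add \<Rightarrow> 'g) \<Rightarrow> ('g \<Rightarrow> 'g \<Rightarrow> 'g) \<Rightarrow> 'g set \<Rightarrow> 'g set \<Rightarrow> ('g \<Rightarrow> complex) set \<Rightarrow>
     'g set \<Rightarrow> ('g \<Rightarrow> complex) \<Rightarrow> bool" where
  "has_highest_weight sc br S H R V \<mu> \<longleftrightarrow>
     (\<exists>v\<in>V. v \<noteq> 0 \<and> (\<forall>h\<in>H. br h v = sc (\<mu> h) v) \<and>
        (\<forall>\<alpha>\<in>roots sc br S H. nonneg_comb R \<alpha> \<longrightarrow>
           (\<forall>x\<in>weight_space sc br S H \<alpha>. br x v = 0)))"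


section \<open>Lie tori\<close>

definition joint_eigenspace ::
  "(complex \<Rightarrow> 'g \<Rightarrow> 'g) \<Rightarrow> ('g \<Rightarrow> 'g) \<Rightarrow> ('n::finite \<Rightarrow> 'g \<Rightarrow> 'g) \<Rightarrow> complex \<Rightarrow> ('n \<Rightarrow> complex) \<Rightarrow>
     int \<Rightarrow> int ^ 'n \<Rightarrow> 'g set" where
  "joint_eigenspace sc \<sigma>0 \<sigma> \<xi>0 \<xi> k0 k =
     {X. \<sigma>0 X = sc (\<xi>0 powi k0) X \<and> (\<forall>i. \<sigma> i X = sc (\<xi> i powi (k $ i)) X)}"

definition eigenspace ::
  "(complex \<Rightarrow> 'g \<Rightarrow> 'g) \<Rightarrow> ('g \<Rightarrow> 'g) \<Rightarrow> complex \<Rightarrow> int \<Rightarrow> 'g set" where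
  "eigenspace sc \<sigma>0 \<xi>0 k0 = {X. \<sigma>0 X = sc (\<xi>0 powi k0) X}"

definition lie_torus ::
  "(complex \<Rightarrow> 'g::ab_group_add \<Rightarrow> 'g) \<Rightarrow> ('g \<Rightarrow> 'g \<Rightarrow> 'g) \<Rightarrow> (int \<Rightarrow> int ^ 'n::finite \<Rightarrow> 'g set) \<Rightarrow>
     'g set \<Rightarrow> ('g \<Rightarrow> complex) set \<Rightarrow> bool" where
  "lie_torus sc br G H R \<longleftrightarrow>
     simple_lie sc br (G 0 0) \<and>
     cartan_subalgebra sc br (G 0 0) H \<and> root_base sc br (G 0 0) H R \<and>
     (\<forall>k0 k. \<exists>U V.
        lie_submodule sc br (G 0 0) U \<and> lie_submodule sc br (G 0 0) V \<and>
        U \<inter> V = {0} \<and> G k0 k = {u + v | u v. u \<in> U \<and> v \<in> V} \<and>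
        (\<forall>x\<in>G 0 0. \<forall>u\<in>U. br x u = 0) \<and>
        (V = {0} \<or>
         irreducible_submodule sc br (G 0 0) V \<and>
         (\<exists>\<theta>. highest_in R (roots sc br (G 0 0) H) \<theta> \<and>
               has_highest_weight sc br (G 0 0) H R V \<theta> \<or>
              \<not> simply_laced sc br (G 0 0) H \<and> highest_in R (short_roots sc br (G 0 0) H) \<theta> \<and>
               has_highest_weight sc br (G 0 0) H R V \<theta> \<or>
              type_B sc br (G 0 0) H R \<and> highest_in R (short_roots sc br (G 0 0) H) \<theta> \<and>
               has_highest_weight sc br (G 0 0) H R V (\<lambda>h. 2 * \<theta> h))))"


section \<open>Lie algebras with explicit carrier\<close>

record 'a lie_alg =
  Carrier :: "'a set"
  Plus :: "'a \<Rightarrow> 'a \<Rightarrow> 'a"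
  Scale :: "complex \<Rightarrow> 'a \<Rightarrow> 'a"
  Bracket :: "'a \<Rightarrow> 'a \<Rightarrow> 'a"

definition lie_hom :: "'a lie_alg \<Rightarrow> 'b lie_alg \<Rightarrow> ('a \<Rightarrow> 'b) \<Rightarrow> bool" where
  "lie_hom A B f \<longleftrightarrow>
     f \<in> Carrier A \<rightarrow> Carrier B \<and>
     (\<forall>x\<in>Carrier A. \<forall>y\<in>Carrier A. f (Plus A x y) = Plus B (f x) (f y)) \<and>
     (\<forall>c. \<forall>x\<in>Carrier A. f (Scale A c x) = Scale B c (f x)) \<and>
     (\<forall>x\<in>Carrier A. \<forall>y\<in>Carrier A. f (Bracket A x y) = Bracket B (f x) (f y))"

definition lie_isomorphic :: "'a lie_alg \<Rightarrow> 'b lie_alg \<Rightarrow> bool" where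
  "lie_isomorphic A B \<longleftrightarrow> (\<exists>f. lie_hom A B f \<and> bij_betw f (Carrier A) (Carrier B))"

definition lie_coset :: "'a lie_alg \<Rightarrow> 'a set \<Rightarrow> 'a \<Rightarrow> 'a set" where
  "lie_coset A J x = Plus A x ` J"

definition lie_quotient :: "'a lie_alg \<Rightarrow> 'a set \<Rightarrow> 'a set lie_alg" where
  "lie_quotient A J =
     \<lparr> Carrier = lie_coset A J ` Carrier A,
       Plus = (\<lambda>X Y. \<Union>x\<in>X. \<Union>y\<in>Y. lie_coset A J (Plus A x y)),
       Scale = (\<lambda>c X. \<Union>x\<in>X. lie_coset A J (Scale A c x)),
       Bracket = (\<lambda>X Y. \<Union>x\<in>X. \<Union>y\<in>Y. lie_coset A J (Bracket A x y)) \<rparr>"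

definition lie_copies :: "nat \<Rightarrow> 'a lie_alg \<Rightarrow> (nat \<Rightarrow> 'a) lie_alg" where
  "lie_copies N A =
     \<lparr> Carrier = {1..N} \<rightarrow>\<^sub>E Carrier A,
       Plus = (\<lambda>x y. \<lambda>j\<in>{1..N}. Plus A (x j) (y j)),
       Scale = (\<lambda>c x. \<lambda>j\<in>{1..N}. Scale A c (x j)),
       Bracket = (\<lambda>x y. \<lambda>j\<in>{1..N}. Bracket A (x j) (y j)) \<rparr>"


section \<open>The multiloop algebra with partial centre\<close>

text \<open>The Laurent polynomial ring in variables indexed by \<open>'n\<close> is the group algebra
  \<open>(int ^ 'n) \<Rightarrow>\<^sub>0 complex\<close>, with \<open>t\<^sup>k\<close> being \<open>single k 1\<close>.\<close>

definition Gam :: "('n::finite \<Rightarrow> nat) \<Rightarrow> (int ^ 'n) set" where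
  "Gam m = {k. \<forall>i. int (m i) dvd k $ i}"

definition laurent_sub :: "('n::finite \<Rightarrow> nat) \<Rightarrow> ((int ^ 'n) \<Rightarrow>\<^sub>0 complex) set" where
  "laurent_sub m = {p. Poly_Mapping.keys p \<subseteq> Gam m}"

definition ideal_of :: "'r::comm_ring_1 set \<Rightarrow> 'r set \<Rightarrow> bool" where
  "ideal_of A J \<longleftrightarrow>
     J \<subseteq> A \<and> 0 \<in> J \<and> (\<forall>p\<in>J. \<forall>q\<in>J. p + q \<in> J) \<and> (\<forall>a\<in>A. \<forall>p\<in>J. a * p \<in> J)"

text \<open>A pair \<open>(f, c)\<close> stands for
  \<open>\<Sum> f(k\<^sub>0,k) t\<^sub>0\<^bsup>k\<^sub>0\<^esup> t\<^sup>k + K \<otimes> c\<close>.\<close>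

type_synonym ('g, 'n) loop_elt = "((int \<times> (int ^ 'n)) \<Rightarrow>\<^sub>0 'g) \<times> ((int ^ 'n) \<Rightarrow>\<^sub>0 complex)"

definition loop_scale ::
  "(complex \<Rightarrow> 'g::ab_group_add \<Rightarrow> 'g) \<Rightarrow> complex \<Rightarrow> ('g, 'n::finite) loop_elt \<Rightarrow> ('g, 'n) loop_elt" where
  "loop_scale sc z = (\<lambda>(f, c). (Poly_Mapping.map (sc z) f, Poly_Mapping.map ((*) z) c))"

definition loop_bracket ::
  "('g::ab_group_add \<Rightarrow> 'g \<Rightarrow> 'g) \<Rightarrow> ('g \<Rightarrow> 'g \<Rightarrow> complex) \<Rightarrow>
     ('g, 'n::finite) loop_elt \<Rightarrow> ('g, 'n) loop_elt \<Rightarrow> ('g, 'n) loop_elt" where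
  "loop_bracket br B = (\<lambda>(f, c) (f', c').
     (\<Sum>(k0, k)\<in>Poly_Mapping.keys f. \<Sum>(l0, l)\<in>Poly_Mapping.keys f'.
        Poly_Mapping.single (k0 + l0, k + l)
          (br (Poly_Mapping.lookup f (k0, k)) (Poly_Mapping.lookup f' (l0, l))),
      \<Sum>(k0, k)\<in>Poly_Mapping.keys f. \<Sum>(l0, l)\<in>Poly_Mapping.keys f'.
        Poly_Mapping.single (k + l)
          (if k0 + l0 = 0
           then B (Poly_Mapping.lookup f (k0, k)) (Poly_Mapping.lookup f' (l0, l)) * of_int k0
           else 0)))"

definition loop_alg ::
  "(complex \<Rightarrow> 'g::ab_group_add \<Rightarrow> 'g) \<Rightarrow> ('g \<Rightarrow> 'g \<Rightarrow> 'g) \<Rightarrow> ('g \<Rightarrow> 'g \<Rightarrow> complex) \<Rightarrow>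
     (int \<Rightarrow> int ^ 'n::finite \<Rightarrow> 'g set) \<Rightarrow> ('n \<Rightarrow> nat) \<Rightarrow> ('g, 'n) loop_elt lie_alg" where
  "loop_alg sc br B G m =
     \<lparr> Carrier = {(f, c). (\<forall>k0 k. Poly_Mapping.lookup f (k0, k) \<in> G k0 k) \<and> c \<in> laurent_sub m},
       Plus = (+),
       Scale = loop_scale sc,
       Bracket = loop_bracket br B \<rparr>"

text \<open>\<open>X t\<^sub>0\<^bsup>k\<^sub>0\<^esup> t\<^sup>k p\<close> for a Laurent polynomial \<open>p\<close>.\<close>

definition loop_term ::
  "(complex \<Rightarrow> 'g::ab_group_add \<Rightarrow> 'g) \<Rightarrow> 'g \<Rightarrow> int \<Rightarrow> int ^ 'n::finite \<Rightarrow>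
     ((int ^ 'n) \<Rightarrow>\<^sub>0 complex) \<Rightarrow> ('g, 'n) loop_elt" where
  "loop_term sc X k0 k p =
     (\<Sum>l\<in>Poly_Mapping.keys p.
        Poly_Mapping.single (k0, k + l) (sc (Poly_Mapping.lookup p l) X), 0)"

definition loop_ideal ::
  "(complex \<Rightarrow> 'g::ab_group_add \<Rightarrow> 'g) \<Rightarrow> (int \<Rightarrow> int ^ 'n::finite \<Rightarrow> 'g set) \<Rightarrow>
     ((int ^ 'n) \<Rightarrow>\<^sub>0 complex) set \<Rightarrow> ('g, 'n) loop_elt set" where
  "loop_ideal sc G J =
     module.span (loop_scale sc)
       ({loop_term sc X k0 k p | X k0 k p. X \<in> G k0 k \<and> p \<in> J} \<union> {(0, p) | p. p \<in> J})"

definition loop_degree :: "int \<Rightarrow> ('g::ab_group_add, 'n::finite) loop_elt set" where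
  "loop_degree d =
     {(f, c). (\<forall>k0 k. (k0, k) \<in> Poly_Mapping.keys f \<longrightarrow> k0 = d) \<and> (d \<noteq> 0 \<longrightarrow> c = 0)}"


section \<open>The affine Lie algebra\<close>

text \<open>A pair \<open>(f, c)\<close> stands for \<open>\<Sum> f(k\<^sub>0) t\<^bsup>k\<^sub>0\<^esup> + c K\<close>.\<close>

type_synonym 'g affine_elt = "(int \<Rightarrow>\<^sub>0 'g) \<times> complex"

definition affine_bracket ::
  "('g::ab_group_add \<Rightarrow> 'g \<Rightarrow> 'g) \<Rightarrow> ('g \<Rightarrow> 'g \<Rightarrow> complex) \<Rightarrow>
     'g affine_elt \<Rightarrow> 'g affine_elt \<Rightarrow> 'g affine_elt" where
  "affine_bracket br B = (\<lambda>(f, c) (f', c').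
     (\<Sum>a\<in>Poly_Mapping.keys f. \<Sum>b\<in>Poly_Mapping.keys f'.
        Poly_Mapping.single (a + b) (br (Poly_Mapping.lookup f a) (Poly_Mapping.lookup f' b)),
      \<Sum>a\<in>Poly_Mapping.keys f. \<Sum>b\<in>Poly_Mapping.keys f'.
        (if a + b = 0
         then B (Poly_Mapping.lookup f a) (Poly_Mapping.lookup f' b) * of_int a
         else 0)))"

definition affine_alg ::
  "(complex \<Rightarrow> 'g::ab_group_add \<Rightarrow> 'g) \<Rightarrow> ('g \<Rightarrow> 'g \<Rightarrow> 'g) \<Rightarrow> ('g \<Rightarrow> 'g \<Rightarrow> complex) \<Rightarrow>
     (int \<Rightarrow> 'g set) \<Rightarrow> 'g affine_elt lie_alg" where
  "affine_alg sc br B G0 =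
     \<lparr> Carrier = {(f, c). \<forall>k0. Poly_Mapping.lookup f k0 \<in> G0 k0},
       Plus = (+),
       Scale = (\<lambda>z (f, c). (Poly_Mapping.map (sc z) f, z * c)),
       Bracket = affine_bracket br B \<rparr>"

definition affine_degree :: "int \<Rightarrow> 'g::ab_group_add affine_elt set" where
  "affine_degree d = {(f, c). Poly_Mapping.keys f \<subseteq> {d} \<and> (d \<noteq> 0 \<longrightarrow> c = 0)}"


section \<open>The evaluation map\<close>

definition multi_indices :: "('n::finite \<Rightarrow> nat) \<Rightarrow> ('n \<Rightarrow> nat) set" where
  "multi_indices Ns = {\<iota>. \<forall>i. 1 \<le> \<iota> i \<and> \<iota> i \<le> Ns i}"

definition point_pow :: "('n::finite \<Rightarrow> nat \<Rightarrow> complex) \<Rightarrow> ('n \<Rightarrow> nat) \<Rightarrow> int ^ 'n \<Rightarrow> complex" where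
  "point_pow a \<iota> q = (\<Prod>i\<in>UNIV. a i (\<iota> i) powi (q $ i))"

text \<open>The linear extension of the values on the spanning elements \<open>X t\<^sub>0\<^bsup>k\<^sub>0\<^esup> t\<^sup>k\<close> and
  \<open>K \<otimes> t\<^sup>k\<close>; compare \<open>ev_map_loop\<close> and \<open>ev_map_central\<close>.\<close>

definition ev_map ::
  "(complex \<Rightarrow> 'g::ab_group_add \<Rightarrow> 'g) \<Rightarrow> ('n::finite \<Rightarrow> nat \<Rightarrow> complex) \<Rightarrow> nat \<Rightarrow> (nat \<Rightarrow> 'n \<Rightarrow> nat) \<Rightarrow>
     ('g, 'n) loop_elt \<Rightarrow> nat \<Rightarrow> 'g affine_elt" where
  "ev_map sc a N I = (\<lambda>(f, c). \<lambda>j\<in>{1..N}.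
     (\<Sum>(k0, k)\<in>Poly_Mapping.keys f.
        Poly_Mapping.single k0 (sc (point_pow a (I j) k) (Poly_Mapping.lookup f (k0, k))),
      \<Sum>k\<in>Poly_Mapping.keys c. Poly_Mapping.lookup c k * point_pow a (I j) k))"

lemma ev_map_loop:
  assumes "vector_space sc"
  shows "ev_map sc a N I (Poly_Mapping.single (k0, k) X, 0) =
    (\<lambda>j\<in>{1..N}. (Poly_Mapping.single k0 (sc (point_pow a (I j) k) X), 0))"
proof -
  interpret vector_space sc by fact
  show ?thesis by (auto simp: ev_map_def restrict_def fun_eq_iff)
qed

lemma ev_map_central:
  "ev_map sc a N I (0, Poly_Mapping.single k 1) =
    (\<lambda>j\<in>{1..N}. (0, point_pow a (I j) k))"
  by (auto simp: ev_map_def restrict_def fun_eq_iff)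

definition point_poly ::
  "('n::finite \<Rightarrow> nat) \<Rightarrow> ('n \<Rightarrow> nat \<Rightarrow> complex) \<Rightarrow> ('n \<Rightarrow> nat) \<Rightarrow> 'n \<Rightarrow> ((int ^ 'n) \<Rightarrow>\<^sub>0 complex)" where
  "point_poly m a Ns i =
     (\<Prod>j=1..Ns i. Poly_Mapping.single (axis i (int (m i))) 1 -
                    Poly_Mapping.single 0 (a i j ^ m i))"

definition point_ideal ::
  "('n::finite \<Rightarrow> nat) \<Rightarrow> ('n \<Rightarrow> nat \<Rightarrow> complex) \<Rightarrow> ('n \<Rightarrow> nat) \<Rightarrow> ((int ^ 'n) \<Rightarrow>\<^sub>0 complex) set" where
  "point_ideal m a Ns = ideal_of (laurent_sub m) hull (point_poly m a Ns ` UNIV)"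

end

(* A Laurent polynomial is determined modulo the ideal I' by its values on the grid: with e_i the
   product over the variables of the Lagrange basis polynomials in t_i^{m_i}, the e_i sum to 1 and
   t^l e_i is congruent to a_i^l e_i modulo I' for l in Gamma, negative exponents included. Hence I'
   is the vanishing ideal of the grid in A(m).
   Surjectivity follows from the e_i together with the fact that every sigma_0-eigenspace is spanned
   by the joint eigenspaces. For the kernel, write X t^k = (X t^r) t^{k-r} with r the residue of k
   modulo the orders m_i. Modulo L'(I') an element f of the kernel becomes the sum over i and r of
   a_i^{-r} (sum over k congruent to r of a_i^k f_k) t^r e_i, and the inner sums vanish because joint
   eigenspaces for different residues are linearly independent. *)

theory Submission
  imports Defs "HOL-Computational_Algebra.Polynomial"
begin

section \<open>Additive maps on finitely supported functions\<close>

text \<open>Elements of A(m) see a grid point only through the powers \<open>a i j ^ m i\<close>.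
  This is why these powers are the interpolation nodes and why they, rather than the
  \<open>a i j\<close>, have to be distinct. The obstacle is that the exponents k of X t^k need not
  lie in \<open>Gam m\<close>. Evaluation at one point merges all k with the same \<open>k0\<close>
  into one coefficient, so its vanishing says nothing about single terms. What evaluation forgets
  modulo \<open>Gam m\<close> is remembered by the eigenvalues: since the roots \<xi> i are
  primitive, distinct residues belong to distinct joint eigenvalues. Within one residue class the
  remaining factor is a monomial of A(m), and interpolation controls the cancellation there. The
  factors a^{-r} cancel the value of t^r at the grid point; they exist because the coordinates are
  nonzero.\<close>

definition psum :: "('k \<Rightarrow> 'a::ab_group_add \<Rightarrow> 'b::ab_group_add) \<Rightarrow> ('k \<Rightarrow>\<^sub>0 'a) \<Rightarrow> 'b" where
  "psum h f = (\<Sum>k\<in>Poly_Mapping.keys f. h k (Poly_Mapping.lookup f k))"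

lemma psum_single:
  assumes "Modules.additive (h k)"
  shows "psum h (Poly_Mapping.single k x) = h k x"
  using Modules.additive.zero[OF assms] by (auto simp: psum_def)

text \<open>\<open>f + g\<close> may have fewer keys than f and g together. As each
  \<open>h k\<close> sends 0 to 0, the sum can be taken over any finite set containing the keys,
  where additivity is termwise.\<close>

lemma additive_psum:
  assumes "\<And>k. Modules.additive (h k)"
  shows "Modules.additive (psum h)"
proof
  fix f g
  show "psum h (f + g) = psum h f + psum h g"
    unfolding psum_def
    by (rule setsum_keys_plus_distrib) (simp_all add: Modules.additive.zero[OF assms] Modules.additive.add[OF assms])
qed

lemma additive_psum_param:
  assumes "\<And>k x. Modules.additive (\<lambda>y. h y k x)"
  shows "Modules.additive (\<lambda>y. psum (h y) f)"
  by standard (simp add: psum_def Modules.additive.add[OF assms] sum.distrib)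

lemma poly_mapping_expand:
  fixes f :: "'k \<Rightarrow>\<^sub>0 'a::ab_group_add"
  shows "(\<Sum>k\<in>Poly_Mapping.keys f. Poly_Mapping.single k (Poly_Mapping.lookup f k)) = f"
  by (rule poly_mapping_eqI)
    (auto simp: lookup_sum lookup_single when_def sum.delta in_keys_iff)

text \<open>The singles, with all their coefficients, generate the finitely supported functions
  additively. Identities about evaluation are reduced to monomials in this way.\<close>

lemma additive_eqI:
  fixes F G :: "('k \<Rightarrow>\<^sub>0 'a::ab_group_add) \<Rightarrow> 'b::ab_group_add"
  assumes "Modules.additive F" "Modules.additive G"
    and "\<And>k x. F (Poly_Mapping.single k x) = G (Poly_Mapping.single k x)"
  shows "F f = G f"
proof -
  let ?s = "\<Sum>k\<in>Poly_Mapping.keys f. Poly_Mapping.single k (Poly_Mapping.lookup f k)"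
  have "F ?s = G ?s"
    by (simp add: Modules.additive.sum[OF assms(1)] Modules.additive.sum[OF assms(2)] assms(3))
  then show ?thesis by (simp add: poly_mapping_expand)
qed

lemma additive_compose:
  assumes "Modules.additive F" "Modules.additive G"
  shows "Modules.additive (\<lambda>x. F (G x))"
  by standard (simp add: Modules.additive.add[OF assms(1)] Modules.additive.add[OF assms(2)])

lemma additive_single: "Modules.additive (Poly_Mapping.single k)"
  by standard (simp add: single_add)

lemma lookup_map_scale:
  "g 0 = 0 \<Longrightarrow> Poly_Mapping.lookup (Poly_Mapping.map g f) k = g (Poly_Mapping.lookup f k)"
  by (simp add: Poly_Mapping.map.rep_eq when_def)

lemma additive_map:
  assumes "Modules.additive g"
  shows "Modules.additive (Poly_Mapping.map g)"
  by standard
    (auto intro!: poly_mapping_eqI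
      simp: lookup_map_scale lookup_add Modules.additive.zero[OF assms] Modules.additive.add[OF assms])

text \<open>The common shape of the loop and affine brackets and of their central terms. The
  exponents enter the summand because the cocycle depends on the degrees in t_0.\<close>

definition bipsum :: "('k \<Rightarrow> 'a::ab_group_add \<Rightarrow> 'l \<Rightarrow> 'b::ab_group_add \<Rightarrow> 'c::ab_group_add) \<Rightarrow>
    ('k \<Rightarrow>\<^sub>0 'a) \<Rightarrow> ('l \<Rightarrow>\<^sub>0 'b) \<Rightarrow> 'c" where
  "bipsum h f g = psum (\<lambda>k x. psum (h k x) g) f"

lemma additive_bipsum_left:
  assumes "\<And>k l y. Modules.additive (\<lambda>x. h k x l y)"
  shows "Modules.additive (\<lambda>f. bipsum h f g)"
  unfolding bipsum_def by (intro additive_psum additive_psum_param assms)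

lemma additive_bipsum_right:
  assumes "\<And>k x l. Modules.additive (h k x l)"
  shows "Modules.additive (bipsum h f)"
  unfolding bipsum_def by (intro additive_psum additive_psum_param assms)

lemma bipsum_single:
  assumes "\<And>k x l. Modules.additive (h k x l)" "\<And>k l y. Modules.additive (\<lambda>x. h k x l y)"
  shows "bipsum h (Poly_Mapping.single k x) (Poly_Mapping.single l y) = h k x l y"
  unfolding bipsum_def by (simp add: psum_single additive_psum_param assms)

lemma biadditive_eqI:
  fixes F G :: "('k \<Rightarrow>\<^sub>0 'a::ab_group_add) \<Rightarrow> ('l \<Rightarrow>\<^sub>0 'b::ab_group_add) \<Rightarrow> 'c::ab_group_add"
  assumes "\<And>f. Modules.additive (F f)" "\<And>f. Modules.additive (G f)"
    and "\<And>g. Modules.additive (\<lambda>f. F f g)" "\<And>g. Modules.additive (\<lambda>f. G f g)"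
    and "\<And>k x l y. F (Poly_Mapping.single k x) (Poly_Mapping.single l y) =
      G (Poly_Mapping.single k x) (Poly_Mapping.single l y)"
  shows "F f g = G f g"
  by (rule additive_eqI[OF assms(3,4)]) (rule additive_eqI[OF assms(1,2)], rule assms(5))

section \<open>Laurent polynomials on a grid of points\<close>

definition laurent_eval ::
  "('n::finite \<Rightarrow> nat \<Rightarrow> complex) \<Rightarrow> ('n \<Rightarrow> nat) \<Rightarrow> ((int ^ 'n) \<Rightarrow>\<^sub>0 complex) \<Rightarrow> complex" where
  "laurent_eval a \<iota> = psum (\<lambda>k c. c * point_pow a \<iota> k)"

text \<open>\<open>poly\<close> takes coefficients and argument from one ring; \<open>C\<close>
  carries the complex coefficients there. With \<open>C = single 0\<close> this substitutes s into a
  complex polynomial.\<close>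

definition poly_at :: "'r::{comm_ring_1} \<Rightarrow> (complex \<Rightarrow> 'r) \<Rightarrow> complex poly \<Rightarrow> 'r" where
  "poly_at s C q = poly (map_poly C q) s"

lemma additive_laurent_eval: "Modules.additive (laurent_eval a \<iota>)"
  unfolding laurent_eval_def by (intro additive_psum) (simp add: Modules.additive_def algebra_simps)

lemma laurent_eval_single:
  "laurent_eval a \<iota> (Poly_Mapping.single k c) = c * point_pow a \<iota> k"
  unfolding laurent_eval_def by (intro psum_single) (simp add: Modules.additive_def algebra_simps)

lemmas laurent_eval_simps =
  Modules.additive.add[OF additive_laurent_eval] Modules.additive.diff[OF additive_laurent_eval]
  Modules.additive.minus[OF additive_laurent_eval]
  Modules.additive.zero[OF additive_laurent_eval] Modules.additive.sum[OF additive_laurent_eval]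
  laurent_eval_single

lemma point_pow_0 [simp]: "point_pow a \<iota> 0 = 1"
  by (simp add: point_pow_def)

lemma laurent_eval_1: "laurent_eval a \<iota> 1 = 1"
  by (metis laurent_eval_single single_one mult_1 point_pow_0)

lemma laurent_sub_simps:
  "0 \<in> laurent_sub m" "1 \<in> laurent_sub m"
  "p \<in> laurent_sub m \<Longrightarrow> q \<in> laurent_sub m \<Longrightarrow> p + q \<in> laurent_sub m"
  "p \<in> laurent_sub m \<Longrightarrow> q \<in> laurent_sub m \<Longrightarrow> p - q \<in> laurent_sub m"
  "p \<in> laurent_sub m \<Longrightarrow> q \<in> laurent_sub m \<Longrightarrow> p * q \<in> laurent_sub m"
  "k \<in> Gam m \<Longrightarrow> Poly_Mapping.single k c \<in> laurent_sub m"
proof -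
  show "p + q \<in> laurent_sub m" if "p \<in> laurent_sub m" "q \<in> laurent_sub m"
    using that keys_add[of p q] by (auto simp: laurent_sub_def)
  show "p - q \<in> laurent_sub m" if "p \<in> laurent_sub m" "q \<in> laurent_sub m"
    using that keys_diff[of p q] by (auto simp: laurent_sub_def)
  show "p * q \<in> laurent_sub m" if "p \<in> laurent_sub m" "q \<in> laurent_sub m"
    using that keys_mult[of p q] by (fastforce simp: laurent_sub_def Gam_def)
qed (auto simp: laurent_sub_def Gam_def)

lemma laurent_sub_sum:
  "(\<And>x. x \<in> S \<Longrightarrow> f x \<in> laurent_sub m) \<Longrightarrow> sum f S \<in> laurent_sub m"
  by (induction S rule: infinite_finite_induct) (auto simp: laurent_sub_simps)

lemma laurent_sub_prod:
  "(\<And>x. x \<in> S \<Longrightarrow> f x \<in> laurent_sub m) \<Longrightarrow> prod f S \<in> laurent_sub m"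
  by (induction S rule: infinite_finite_induct) (auto simp: laurent_sub_simps)

lemma Gam_axis: "axis i (int (m i)) \<in> Gam m"
  by (auto simp: Gam_def axis_def)

lemma axis_0: "axis i 0 = 0"
  by (simp add: vec_eq_iff axis_def)

lemma axis_add: "axis i (x + y :: 'a::monoid_add) = axis i x + axis i y"
  by (simp add: vec_eq_iff axis_def)

lemma axis_uminus: "axis i (- x :: 'a::group_add) = - axis i x"
  by (simp add: vec_eq_iff axis_def)

lemma poly_at_pCons:
  assumes "Modules.additive C"
  shows "poly_at s C (pCons c q) = C c + s * poly_at s C q"
  using Modules.additive.zero[OF assms] by (simp add: poly_at_def map_poly_pCons)

lemma poly_at_add:
  assumes "Modules.additive C"
  shows "poly_at s C (p + q) = poly_at s C p + poly_at s C q"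
  by (induction p q rule: poly_induct2)
    (simp_all add: poly_at_pCons[OF assms] Modules.additive.add[OF assms] algebra_simps,
     simp add: poly_at_def)

lemma poly_at_smult:
  assumes "Modules.additive C" "\<And>x y. C (x * y) = C x * C y"
  shows "poly_at s C (smult c q) = C c * poly_at s C q"
  by (induction q) (simp_all add: poly_at_pCons[OF assms(1)] assms(2) algebra_simps,
     simp add: poly_at_def)

lemma poly_at_mult:
  assumes "Modules.additive C" "\<And>x y. C (x * y) = C x * C y"
  shows "poly_at s C (p * q) = poly_at s C p * poly_at s C q"
proof (induction p)
  case 0
  then show ?case by (simp add: poly_at_def)
next
  case (pCons c p)
  then show ?case
    by (simp add: poly_at_pCons[OF assms(1)] poly_at_add[OF assms(1)] poly_at_smult[OF assms]
        Modules.additive.zero[OF assms(1)] algebra_simps)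
qed

lemma poly_at_1: "Modules.additive C \<Longrightarrow> C 1 = 1 \<Longrightarrow> poly_at s C 1 = 1"
  by (simp add: poly_at_def map_poly_1)

section \<open>Lagrange interpolation in one variable\<close>

definition lagrange :: "complex set \<Rightarrow> complex \<Rightarrow> complex poly" where
  "lagrange S b = smult (inverse (\<Prod>c\<in>S - {b}. b - c)) (\<Prod>c\<in>S - {b}. [:- c, 1:])"

lemma lagrange_self:
  assumes "finite S"
  shows "poly (lagrange S b) b = 1"
  using assms by (simp add: lagrange_def poly_prod)

lemma lagrange_other:
  assumes "finite S" "c \<in> S" "c \<noteq> b"
  shows "poly (lagrange S b) c = 0"
proof -
  have "(\<Prod>x\<in>S - {b}. c - x) = 0" using assms by (intro prod_zero) auto
  then show ?thesis by (simp add: lagrange_def poly_prod)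
qed

text \<open>A Lagrange polynomial lacks exactly the linear factor of its own node; restoring it
  yields a multiple of the polynomial of all nodes. This is the source of the congruences modulo
  I'.\<close>

lemma lagrange_mult:
  assumes "finite S" "b \<in> S"
  shows "[:- b, 1:] * lagrange S b =
    smult (inverse (\<Prod>c\<in>S - {b}. b - c)) (\<Prod>c\<in>S. [:- c, 1:])"
  using assms by (simp add: lagrange_def prod.remove[of S b])

text \<open>Both sides have degree below \<open>card S\<close> and agree at all nodes; for the
  constant 1 the degree bound is the nonemptiness of S.\<close>

lemma sum_lagrange:
  assumes "finite S" "S \<noteq> {}"
  shows "(\<Sum>b\<in>S. lagrange S b) = 1"
proof (rule poly_eqI_degree)
  fix x assume x: "x \<in> S"
  have "(\<Sum>b\<in>S. poly (lagrange S b) x) = (\<Sum>b\<in>S. if b = x then 1 else 0)"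
    using assms x by (intro sum.cong refl) (auto simp: lagrange_self lagrange_other)
  then show "poly (\<Sum>b\<in>S. lagrange S b) x = poly 1 x"
    using assms x by (simp add: poly_sum)
next
  have "degree (lagrange S b) \<le> card S - 1" if "b \<in> S" for b
  proof -
    have "degree (\<Prod>c\<in>S - {b}. [:- c, 1:]) \<le> (\<Sum>c\<in>S - {b}. degree [:- c, 1:])"
      using assms degree_prod_sum_le[of "S - {b}"  "\<lambda>c. [:- c, 1:]"] by (simp add: comp_def)
    also have "\<dots> = card S - 1" using assms that by simp
    finally show ?thesis unfolding lagrange_def using degree_smult_le le_trans by blast
  qed
  then have "degree (\<Sum>b\<in>S. lagrange S b) \<le> card S - 1"
    by (intro degree_sum_le) (use assms in auto)
  then show "degree (\<Sum>b\<in>S. lagrange S b) < card S"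
    using assms by (metis Suc_pred' card_gt_0_iff le_imp_less_Suc)
  show "degree (1 :: complex poly) < card S" using assms by (simp add: card_gt_0_iff)
qed

locale point_grid =
  fixes m :: "'n::finite \<Rightarrow> nat" and a :: "'n \<Rightarrow> nat \<Rightarrow> complex" and Ns :: "'n \<Rightarrow> nat"
  assumes m_pos: "\<And>i. 0 < m i"
    and Ns_pos: "\<And>i. 1 \<le> Ns i"
    and a_nonzero: "\<And>i j. 1 \<le> j \<Longrightarrow> j \<le> Ns i \<Longrightarrow> a i j \<noteq> 0"
    and a_distinct: "\<And>i j j'. 1 \<le> j \<Longrightarrow> j \<le> Ns i \<Longrightarrow> 1 \<le> j' \<Longrightarrow> j' \<le> Ns i \<Longrightarrow> j \<noteq> j' \<Longrightarrow>
               a i j ^ m i \<noteq> a i j' ^ m i"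
begin

lemma point_nonzero: "\<iota> \<in> multi_indices Ns \<Longrightarrow> a i (\<iota> i) \<noteq> 0"
  using a_nonzero by (auto simp: multi_indices_def)

lemma point_pow_add:
  "\<iota> \<in> multi_indices Ns \<Longrightarrow> point_pow a \<iota> (k + l) = point_pow a \<iota> k * point_pow a \<iota> l"
  by (simp add: point_pow_def power_int_add point_nonzero prod.distrib)

lemma point_pow_nonzero: "\<iota> \<in> multi_indices Ns \<Longrightarrow> point_pow a \<iota> k \<noteq> 0"
  by (simp add: point_pow_def point_nonzero)

lemma point_pow_uminus:
  "\<iota> \<in> multi_indices Ns \<Longrightarrow> point_pow a \<iota> (- k) = inverse (point_pow a \<iota> k)"
  by (simp add: point_pow_def power_int_minus prod_inversef[symmetric])

lemma point_pow_axis: "point_pow a \<iota> (axis i (int (m i))) = a i (\<iota> i) ^ m i"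
proof -
  have "point_pow a \<iota> (axis i (int (m i))) = (\<Prod>j\<in>UNIV. if j = i then a i (\<iota> i) ^ m i else 1)"
    unfolding point_pow_def by (intro prod.cong refl) (auto simp: axis_def)
  then show ?thesis by simp
qed

lemma laurent_eval_mult:
  assumes "\<iota> \<in> multi_indices Ns"
  shows "laurent_eval a \<iota> (p * q) = laurent_eval a \<iota> p * laurent_eval a \<iota> q"
proof -
  have 1: "laurent_eval a \<iota> (Poly_Mapping.single k c * q)
      = laurent_eval a \<iota> (Poly_Mapping.single k c) * laurent_eval a \<iota> q" for k c
  proof (rule additive_eqI[where f = q])
    show "Modules.additive (\<lambda>q. laurent_eval a \<iota> (Poly_Mapping.single k c * q))"
      "Modules.additive (\<lambda>q. laurent_eval a \<iota> (Poly_Mapping.single k c) * laurent_eval a \<iota> q)"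
      by (simp_all add: Modules.additive_def laurent_eval_simps(1) algebra_simps)
  qed (simp add: mult_single laurent_eval_single point_pow_add[OF assms])
  show ?thesis
  proof (rule additive_eqI[where f = p])
    show "Modules.additive (\<lambda>p. laurent_eval a \<iota> (p * q))"
      "Modules.additive (\<lambda>p. laurent_eval a \<iota> p * laurent_eval a \<iota> q)"
      by (simp_all add: Modules.additive_def laurent_eval_simps(1) algebra_simps)
  qed (rule 1)
qed

lemma laurent_eval_prod:
  assumes "\<iota> \<in> multi_indices Ns"
  shows "laurent_eval a \<iota> (prod f S) = (\<Prod>x\<in>S. laurent_eval a \<iota> (f x))"
  by (induction S rule: infinite_finite_induct)
    (simp_all add: laurent_eval_1 laurent_eval_mult[OF assms])

section \<open>Grid idempotents and congruences modulo I'\<close>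

abbreviation "I' \<equiv> point_ideal m a Ns"

text \<open>The hull is the intersection of all ideals of A(m) containing the generators, and
  closure properties pass to intersections. Multipliers must lie in \<open>laurent_sub m\<close>,
  which explains the recurring checks of exponents against \<open>Gam m\<close>.\<close>

lemma
  shows I'_0: "0 \<in> I'"
    and I'_add: "p \<in> I' \<Longrightarrow> q \<in> I' \<Longrightarrow> p + q \<in> I'"
    and I'_mult: "r \<in> laurent_sub m \<Longrightarrow> p \<in> I' \<Longrightarrow> r * p \<in> I'"
    and I'_gen: "point_poly m a Ns i \<in> I'"
  by (auto simp: point_ideal_def hull_def ideal_of_def)

lemma I'_sum: "(\<And>x. x \<in> S \<Longrightarrow> f x \<in> I') \<Longrightarrow> sum f S \<in> I'"
  by (induction S rule: infinite_finite_induct) (auto intro: I'_0 I'_add)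

text \<open>The ring homomorphism from C[x] to A(m) that sends x to t_i^{m_i}; it transports
  one-variable interpolation to coordinate i.\<close>

definition coord_pol :: "'n \<Rightarrow> complex poly \<Rightarrow> (int ^ 'n) \<Rightarrow>\<^sub>0 complex" where
  "coord_pol i = poly_at (Poly_Mapping.single (axis i (int (m i))) 1) (Poly_Mapping.single 0)"

lemma coord_pol_simps:
  "coord_pol i 0 = 0" "coord_pol i 1 = 1"
  "coord_pol i (p + q) = coord_pol i p + coord_pol i q"
  "coord_pol i (smult c q) = Poly_Mapping.single 0 c * coord_pol i q"
  "coord_pol i (p * q) = coord_pol i p * coord_pol i q"
  "coord_pol i (pCons c q) =
     Poly_Mapping.single 0 c + Poly_Mapping.single (axis i (int (m i))) 1 * coord_pol i q"
  unfolding coord_pol_def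
  by (simp_all add: poly_at_add poly_at_smult poly_at_mult poly_at_pCons poly_at_1
      additive_single mult_single) (simp add: poly_at_def)

lemma coord_pol_linear:
  "coord_pol i [:- b, 1:] =
     Poly_Mapping.single (axis i (int (m i))) 1 - Poly_Mapping.single 0 b"
  by (simp add: coord_pol_simps single_uminus)

lemma coord_pol_sum: "coord_pol i (sum f S) = (\<Sum>x\<in>S. coord_pol i (f x))"
  by (induction S rule: infinite_finite_induct) (simp_all add: coord_pol_simps)

lemma coord_pol_prod: "coord_pol i (prod f S) = (\<Prod>x\<in>S. coord_pol i (f x))"
  by (induction S rule: infinite_finite_induct) (simp_all add: coord_pol_simps)

lemma coord_pol_in: "coord_pol i q \<in> laurent_sub m"
proof (induction q)
  case 0
  show ?case by (simp add: coord_pol_simps laurent_sub_simps)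
next
  case (pCons c q)
  then show ?case
    unfolding coord_pol_simps by (intro laurent_sub_simps Gam_axis) (simp_all add: Gam_def)
qed

lemma laurent_eval_coord_pol:
  assumes "\<iota> \<in> multi_indices Ns"
  shows "laurent_eval a \<iota> (coord_pol i q) = poly q (a i (\<iota> i) ^ m i)"
  by (induction q)
    (simp_all add: coord_pol_simps laurent_eval_simps laurent_eval_mult[OF assms] point_pow_axis)

definition coord_set :: "'n \<Rightarrow> complex set" where
  "coord_set i = (\<lambda>j. a i j ^ m i) ` {1..Ns i}"

lemma coord_inj: "inj_on (\<lambda>j. a i j ^ m i) {1..Ns i}"
  by (rule inj_onI) (metis a_distinct atLeastAtMost_iff)

lemma point_poly_eq: "point_poly m a Ns i = coord_pol i (\<Prod>b\<in>coord_set i. [:- b, 1:])"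
  unfolding coord_set_def
  by (simp add: prod.reindex coord_inj coord_pol_prod coord_pol_linear point_poly_def
      del: One_nat_def)

text \<open>For \<iota> in the grid this represents a primitive idempotent of the quotient of A(m)
  by I', the indicator function of one grid point.\<close>

definition idem :: "('n \<Rightarrow> nat) \<Rightarrow> (int ^ 'n) \<Rightarrow>\<^sub>0 complex" where
  "idem \<iota> = (\<Prod>i\<in>UNIV. coord_pol i (lagrange (coord_set i) (a i (\<iota> i) ^ m i)))"

lemma idem_in: "idem \<iota> \<in> laurent_sub m"
  unfolding idem_def by (intro laurent_sub_prod coord_pol_in)

lemma coord_set_finite: "finite (coord_set i)" "coord_set i \<noteq> {}"
  using Ns_pos[of i] by (auto simp: coord_set_def)

lemma coord_set_mem: "\<iota> \<in> multi_indices Ns \<Longrightarrow> a i (\<iota> i) ^ m i \<in> coord_set i"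
  by (auto simp: coord_set_def multi_indices_def)

text \<open>Distinct indices differ in some coordinate i; their nodes there are distinct, so the
  i-th Lagrange factor vanishes.\<close>

lemma laurent_eval_idem:
  assumes "\<iota> \<in> multi_indices Ns" "\<kappa> \<in> multi_indices Ns"
  shows "laurent_eval a \<kappa> (idem \<iota>) = (if \<iota> = \<kappa> then 1 else 0)"
proof (cases "\<iota> = \<kappa>")
  case True
  then show ?thesis
    using assms by (simp add: idem_def laurent_eval_prod laurent_eval_coord_pol lagrange_self
        coord_set_finite)
next
  case False
  then obtain i where i: "\<iota> i \<noteq> \<kappa> i" by auto
  have "a i (\<kappa> i) ^ m i \<noteq> a i (\<iota> i) ^ m i"
    using assms i a_distinct[of "\<kappa> i" i "\<iota> i"] by (auto simp: multi_indices_def)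
  then have "laurent_eval a \<kappa> (coord_pol i (lagrange (coord_set i) (a i (\<iota> i) ^ m i))) = 0"
    using assms by (simp add: laurent_eval_coord_pol lagrange_other coord_set_finite coord_set_mem)
  then have "(\<Prod>i\<in>UNIV. laurent_eval a \<kappa> (coord_pol i (lagrange (coord_set i) (a i (\<iota> i) ^ m i)))) = 0"
    by (intro prod_zero) auto
  with False assms(2) show ?thesis by (simp add: idem_def laurent_eval_prod)
qed

text \<open>An identity in A(m), not only a congruence: each coordinate has its own partition of
  unity, and expanding the product of these sums runs over all choices of one node per
  coordinate.\<close>

lemma sum_idem: "(\<Sum>\<iota>\<in>multi_indices Ns. idem \<iota>) = 1"
proof -
  have 1: "(\<Sum>j\<in>{1..Ns i}. coord_pol i (lagrange (coord_set i) (a i j ^ m i))) = 1" for i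
  proof -
    have "(\<Sum>j\<in>{1..Ns i}. coord_pol i (lagrange (coord_set i) (a i j ^ m i)))
        = (\<Sum>b\<in>coord_set i. coord_pol i (lagrange (coord_set i) b))"
      unfolding coord_set_def[of i] by (simp add: sum.reindex[OF coord_inj] comp_def del: One_nat_def)
    also have "\<dots> = 1"
      by (simp add: coord_pol_sum[symmetric] sum_lagrange coord_set_finite coord_pol_simps)
    finally show ?thesis .
  qed
  have "(\<Prod>i\<in>UNIV. \<Sum>j\<in>{1..Ns i}. coord_pol i (lagrange (coord_set i) (a i j ^ m i)))
      = (\<Sum>\<iota>\<in>Pi\<^sub>E UNIV (\<lambda>i. {1..Ns i}). idem \<iota>)"
    unfolding idem_def by (rule prod_sum_PiE) auto
  moreover have "Pi\<^sub>E UNIV (\<lambda>i. {1..Ns i}) = multi_indices Ns"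
    by (auto simp: multi_indices_def PiE_def)
  ultimately show ?thesis by (simp add: 1 del: One_nat_def)
qed

text \<open>The exponents satisfying the congruence form a group, so it suffices to check generators.\<close>

definition eval_cong :: "('n \<Rightarrow> nat) \<Rightarrow> (int ^ 'n) \<Rightarrow> bool" where
  "eval_cong \<iota> l \<longleftrightarrow> l \<in> Gam m \<and>
     Poly_Mapping.single l 1 * idem \<iota> - Poly_Mapping.single 0 (point_pow a \<iota> l) * idem \<iota> \<in> I'"

text \<open>The difference t_i^{m_i} - b is the very factor missing from the i-th Lagrange factor of
  \<open>idem \<iota>\<close>, so the product is a multiple of the i-th generator.\<close>

lemma eval_cong_axis:
  assumes "\<iota> \<in> multi_indices Ns"
  shows "eval_cong \<iota> (axis i (int (m i)))"
proof -
  let ?b = "a i (\<iota> i) ^ m i" and ?l = "\<lambda>i. lagrange (coord_set i) (a i (\<iota> i) ^ m i)"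
  have "idem \<iota> = coord_pol i (?l i) * (\<Prod>j\<in>UNIV - {i}. coord_pol j (?l j))"
    unfolding idem_def by (subst prod.remove[of UNIV i]) auto
  then have "coord_pol i [:- ?b, 1:] * idem \<iota>
    = coord_pol i ([:- ?b, 1:] * ?l i) * (\<Prod>j\<in>UNIV - {i}. coord_pol j (?l j))"
    by (simp only: coord_pol_simps(5) mult.assoc)
  also have "\<dots> = Poly_Mapping.single 0 (inverse (\<Prod>c\<in>coord_set i - {?b}. ?b - c))
      * (\<Prod>j\<in>UNIV - {i}. coord_pol j (?l j)) * point_poly m a Ns i"
    by (subst lagrange_mult)
      (simp_all add: coord_set_finite coord_set_mem[OF assms] coord_pol_simps(4) point_poly_eq mult_ac)
  also have "\<dots> \<in> I'"
    by (intro I'_mult I'_gen laurent_sub_simps laurent_sub_prod coord_pol_in) (simp add: Gam_def)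
  finally show ?thesis
    by (simp add: eval_cong_def Gam_axis point_pow_axis coord_pol_linear left_diff_distrib)
qed

lemma eval_cong_add:
  assumes \<iota>: "\<iota> \<in> multi_indices Ns" and "eval_cong \<iota> k" "eval_cong \<iota> l"
  shows "eval_cong \<iota> (k + l)"
proof -
  let ?d = "\<lambda>k. Poly_Mapping.single k 1 * idem \<iota> - Poly_Mapping.single 0 (point_pow a \<iota> k) * idem \<iota>"
  have "Poly_Mapping.single (k + l) 1 = Poly_Mapping.single k 1 * Poly_Mapping.single l (1 :: complex)"
    "Poly_Mapping.single 0 (point_pow a \<iota> (k + l)) =
      Poly_Mapping.single 0 (point_pow a \<iota> k) * Poly_Mapping.single (0 :: int ^ 'n) (point_pow a \<iota> l)"
    by (simp_all add: mult_single point_pow_add[OF \<iota>])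
  \<comment> \<open>The splitting xy - uv = x(y - v) + v(x - u), with x, y the monomials and u, v
    their values.\<close>
  then have "?d (k + l) = Poly_Mapping.single k 1 * ?d l + Poly_Mapping.single 0 (point_pow a \<iota> l) * ?d k"
    by (simp only:) (simp add: ring_distribs mult_ac)
  also have "\<dots> \<in> I'"
    using assms by (intro I'_add I'_mult laurent_sub_simps) (auto simp: eval_cong_def Gam_def)
  finally show ?thesis using assms by (auto simp: eval_cong_def Gam_def)
qed

text \<open>Multiplying t^k - a^k by - a^{-k} t^{-k} gives t^{-k} - a^{-k}. The multiplier lies in
  A(m), where t^k is a unit, and its scalar exists because the coordinates are nonzero.\<close>

lemma eval_cong_uminus:
  assumes \<iota>: "\<iota> \<in> multi_indices Ns" and "eval_cong \<iota> k"
  shows "eval_cong \<iota> (- k)"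
proof -
  let ?d = "\<lambda>k. Poly_Mapping.single k 1 * idem \<iota> - Poly_Mapping.single 0 (point_pow a \<iota> k) * idem \<iota>"
  have "?d (- k) = Poly_Mapping.single (- k) (- point_pow a \<iota> (- k)) * ?d k"
    by (simp add: right_diff_distrib mult.assoc[symmetric] mult_single point_pow_uminus[OF \<iota>]
        point_pow_nonzero[OF \<iota>] single_uminus)
  also have "\<dots> \<in> I'"
    using assms by (intro I'_mult laurent_sub_simps) (auto simp: eval_cong_def Gam_def)
  finally show ?thesis using assms by (auto simp: eval_cong_def Gam_def)
qed

lemma eval_cong_0: "eval_cong \<iota> 0"
  by (simp add: eval_cong_def Gam_def I'_0)

lemma eval_cong_Gam:
  assumes \<iota>: "\<iota> \<in> multi_indices Ns" and l: "l \<in> Gam m"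
  shows "eval_cong \<iota> l"
proof -
  have nat: "eval_cong \<iota> (axis i (int (m i) * int c))" for i c
  proof (induction c)
    case 0
    then show ?case by (simp add: eval_cong_0 axis_0)
  next
    case (Suc c)
    have "axis i (int (m i) * int (Suc c)) = axis i (int (m i)) + axis i (int (m i) * int c)"
      by (simp add: distrib_left flip: axis_add)
    then show ?case using eval_cong_add[OF \<iota> eval_cong_axis[OF \<iota>] Suc] by simp
  qed
  have int: "eval_cong \<iota> (axis i (int (m i) * c))" for i c
  proof (cases c rule: int_cases2)
    case (nonpos n)
    have "axis i (int (m i) * c) = - axis i (int (m i) * int n)"
      by (simp add: nonpos axis_uminus)
    then show ?thesis using eval_cong_uminus[OF \<iota> nat] by simp
  qed (use nat in simp)
  have "eval_cong \<iota> (\<Sum>i\<in>S. axis i (l $ i))" if "finite S" for S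
    using that
  proof induction
    case (insert i S)
    obtain c where "l $ i = int (m i) * c" using l by (auto simp: Gam_def dvd_def)
    with insert show ?case by (simp add: eval_cong_add[OF \<iota>] int)
  qed (simp add: eval_cong_0)
  moreover have "(\<Sum>i\<in>UNIV. axis i (l $ i)) = l"
    by (simp add: vec_eq_iff axis_def sum.delta if_distrib cong: if_cong)
  ultimately show ?thesis by (metis finite_class.finite_UNIV)
qed

text \<open>Multiply the monomial by 1, written as the sum of all \<open>idem \<iota>\<close>, and
  replace each product by its congruent value.\<close>

lemma interpolation_monomial:
  assumes "l \<in> Gam m"
  shows "Poly_Mapping.single l c -
      (\<Sum>\<iota>\<in>multi_indices Ns. Poly_Mapping.single 0 (c * point_pow a \<iota> l) * idem \<iota>) \<in> I'"
proof -
  have "Poly_Mapping.single l c -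
      (\<Sum>\<iota>\<in>multi_indices Ns. Poly_Mapping.single 0 (c * point_pow a \<iota> l) * idem \<iota>) =
    Poly_Mapping.single l c * (\<Sum>\<iota>\<in>multi_indices Ns. idem \<iota>) -
      (\<Sum>\<iota>\<in>multi_indices Ns. Poly_Mapping.single 0 (c * point_pow a \<iota> l) * idem \<iota>)"
    by (simp add: sum_idem)
  also have "\<dots> = (\<Sum>\<iota>\<in>multi_indices Ns. Poly_Mapping.single 0 c *
      (Poly_Mapping.single l 1 * idem \<iota> - Poly_Mapping.single 0 (point_pow a \<iota> l) * idem \<iota>))"
    by (simp add: sum_distrib_left sum_subtractf[symmetric] right_diff_distrib
        mult.assoc[symmetric] mult_single)
  also have "\<dots> \<in> I'"
    using eval_cong_Gam[OF _ assms]
    by (intro I'_sum I'_mult laurent_sub_simps) (auto simp: eval_cong_def Gam_def)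
  finally show ?thesis .
qed

lemma interpolation:
  assumes p: "p \<in> laurent_sub m"
  shows "p - (\<Sum>\<iota>\<in>multi_indices Ns. Poly_Mapping.single 0 (laurent_eval a \<iota> p) * idem \<iota>) \<in> I'"
proof -
  define D where "D p = p - (\<Sum>\<iota>\<in>multi_indices Ns.
      Poly_Mapping.single 0 (laurent_eval a \<iota> p) * idem \<iota>)" for p
  have D: "Modules.additive D"
    by standard (simp add: D_def laurent_eval_simps single_add ring_distribs sum.distrib)
  have "D p = D (\<Sum>k\<in>Poly_Mapping.keys p. Poly_Mapping.single k (Poly_Mapping.lookup p k))"
    by (simp add: poly_mapping_expand)
  also have "\<dots> = (\<Sum>k\<in>Poly_Mapping.keys p. D (Poly_Mapping.single k (Poly_Mapping.lookup p k)))"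
    by (rule Modules.additive.sum[OF D])
  also have "\<dots> \<in> I'"
    using p interpolation_monomial
    by (intro I'_sum) (auto simp: D_def laurent_eval_single laurent_sub_def)
  finally show ?thesis by (simp add: D_def)
qed

text \<open>Vanishing on the grid defines an ideal containing the generators, so minimality of the
  hull gives one inclusion. Conversely, if p vanishes on the grid, its interpolating sum is 0, and
  the congruence puts p itself into I'.\<close>

lemma point_ideal_eq_vanishing:
  "I' = {p \<in> laurent_sub m. \<forall>\<iota>\<in>multi_indices Ns. laurent_eval a \<iota> p = 0}" (is "_ = ?V")
proof
  have "ideal_of (laurent_sub m) ?V"
    by (auto simp: ideal_of_def laurent_sub_simps laurent_eval_simps laurent_eval_mult)
  moreover have "point_poly m a Ns i \<in> ?V" for i
  proof -
    have "(\<Prod>c\<in>coord_set i. a i (\<iota> i) ^ m i - c) = 0" if "\<iota> \<in> multi_indices Ns" for \<iota>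
      using coord_set_finite coord_set_mem[OF that] by (intro prod_zero) auto
    then show ?thesis
      by (auto simp: point_poly_eq coord_pol_in laurent_eval_coord_pol poly_prod)
  qed
  ultimately show "I' \<subseteq> ?V"
    unfolding point_ideal_def by (intro hull_minimal) auto
  show "?V \<subseteq> I'"
    using interpolation by fastforce
qed

end

section \<open>Quotients of Lie algebras and their isomorphisms\<close>

text \<open>The condition \<open>kill\<close> ranges over all \<open>x\<close>, not only over the carrier: it is applied to brackets,
  and the multiloop carrier is closed under brackets only because the form is invariant under the
  automorphisms \<open>\<sigma>\<close>, a fact the proof thereby avoids.\<close>

lemma lie_isomorphic_quotient:
  fixes A :: "'a::ab_group_add lie_alg"
  assumes hom: "lie_hom A M \<phi>" and surj: "\<phi> ` Carrier A = Carrier M"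
    and plus: "Plus A = (+)"
    and carrier: "\<And>x z. x \<in> Carrier A \<Longrightarrow> z \<in> J \<Longrightarrow> x + z \<in> Carrier A"
    and J0: "0 \<in> J" and J_add: "\<And>x y. x \<in> J \<Longrightarrow> y \<in> J \<Longrightarrow> x + y \<in> J"
    and kill: "\<And>x z. z \<in> J \<Longrightarrow> \<phi> (x + z) = \<phi> x"
    and ker: "\<And>x y. x \<in> Carrier A \<Longrightarrow> y \<in> Carrier A \<Longrightarrow> \<phi> x = \<phi> y \<Longrightarrow> x - y \<in> J"
  shows "lie_isomorphic (lie_quotient A J) M"
proof -
  define f where "f X = \<phi> (SOME x. x \<in> X)" for X
  have coset_iff: "z \<in> lie_coset A J x \<longleftrightarrow> (\<exists>j\<in>J. z = x + j)" for x z
    by (auto simp: lie_coset_def plus)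
  have self: "x \<in> lie_coset A J x" for x using J0 by (auto simp: coset_iff)
  \<comment> \<open>Operations of the quotient are unions of cosets over representatives. Such a
    union need not be identified with a single coset: on any nonempty set where \<phi> is constant,
    \<open>f\<close> takes that constant value.\<close>
  have f_eq: "f X = v" if "x \<in> X" "\<And>z. z \<in> X \<Longrightarrow> \<phi> z = v" for X x v
    unfolding f_def using that by (metis someI)
  have f_coset: "f (lie_coset A J x) = \<phi> x" for x
    by (rule f_eq[OF self]) (auto simp: coset_iff kill)
  have cosetD: "z \<in> Carrier A \<and> \<phi> z = \<phi> x" if "x \<in> Carrier A" "z \<in> lie_coset A J x" for x z
    using that by (auto simp: coset_iff kill carrier)
  note hom' = hom[unfolded lie_hom_def]
  have "lie_hom (lie_quotient A J) M f"
    unfolding lie_hom_def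
  proof (intro conjI ballI allI)
    show "f \<in> Carrier (lie_quotient A J) \<rightarrow> Carrier M"
      using hom' by (auto simp: lie_quotient_def f_coset)
    fix X assume "X \<in> Carrier (lie_quotient A J)"
    then obtain x where x: "x \<in> Carrier A" "X = lie_coset A J x"
      by (auto simp: lie_quotient_def)
    show "f (Scale (lie_quotient A J) c X) = Scale M c (f X)" for c
    proof (rule f_eq)
      show "Scale A c x \<in> Scale (lie_quotient A J) c X"
        using self by (auto simp: lie_quotient_def x(2))
      fix z assume "z \<in> Scale (lie_quotient A J) c X"
      then obtain x' where "x' \<in> X" "z \<in> lie_coset A J (Scale A c x')"
        by (auto simp: lie_quotient_def)
      then show "\<phi> z = Scale M c (f X)"
        using cosetD[OF x(1), of x'] hom' x(2) by (auto simp: coset_iff kill f_coset)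
    qed
    fix Y assume "Y \<in> Carrier (lie_quotient A J)"
    then obtain y where y: "y \<in> Carrier A" "Y = lie_coset A J y"
      by (auto simp: lie_quotient_def)
    show "f (Plus (lie_quotient A J) X Y) = Plus M (f X) (f Y)"
    proof (rule f_eq)
      show "Plus A x y \<in> Plus (lie_quotient A J) X Y"
        using self by (auto simp: lie_quotient_def x(2) y(2) intro!: bexI)
      fix z assume "z \<in> Plus (lie_quotient A J) X Y"
      then obtain x' y' where "x' \<in> X" "y' \<in> Y" "z \<in> lie_coset A J (Plus A x' y')"
        by (auto simp: lie_quotient_def)
      then show "\<phi> z = Plus M (f X) (f Y)"
        using cosetD[OF x(1), of x'] cosetD[OF y(1), of y'] hom' x(2) y(2)
        by (auto simp: coset_iff kill f_coset)
    qed
    show "f (Bracket (lie_quotient A J) X Y) = Bracket M (f X) (f Y)"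
    proof (rule f_eq)
      show "Bracket A x y \<in> Bracket (lie_quotient A J) X Y"
        using self by (auto simp: lie_quotient_def x(2) y(2) intro!: bexI)
      fix z assume "z \<in> Bracket (lie_quotient A J) X Y"
      then obtain x' y' where "x' \<in> X" "y' \<in> Y" "z \<in> lie_coset A J (Bracket A x' y')"
        by (auto simp: lie_quotient_def)
      then show "\<phi> z = Bracket M (f X) (f Y)"
        using cosetD[OF x(1), of x'] cosetD[OF y(1), of y'] hom' x(2) y(2)
        by (auto simp: coset_iff kill f_coset)
    qed
  qed
  moreover have "bij_betw f (Carrier (lie_quotient A J)) (Carrier M)"
    unfolding bij_betw_def
  proof
    show "f ` Carrier (lie_quotient A J) = Carrier M"
      by (simp add: lie_quotient_def image_image f_coset surj)
    \<comment> \<open>Closure of \<open>J\<close> under addition gives one inclusion from x - y; the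
      reverse inclusion comes from \<open>ker\<close> with x and y exchanged instead of from
      negation.\<close>
    have sub: "lie_coset A J x \<subseteq> lie_coset A J y" if "x - y \<in> J" for x y
    proof
      fix z assume "z \<in> lie_coset A J x"
      then obtain j where "j \<in> J" "z = y + ((x - y) + j)" by (auto simp: coset_iff)
      then show "z \<in> lie_coset A J y" using J_add[OF that] unfolding coset_iff by blast
    qed
    show "inj_on f (Carrier (lie_quotient A J))"
    proof (rule inj_onI)
      fix X Y assume "X \<in> Carrier (lie_quotient A J)" "Y \<in> Carrier (lie_quotient A J)" "f X = f Y"
      then obtain x y where "x \<in> Carrier A" "y \<in> Carrier A" "\<phi> x = \<phi> y"
        "X = lie_coset A J x" "Y = lie_coset A J y"
        by (auto simp: lie_quotient_def f_coset)
      then show "X = Y" using ker[of x y] ker[of y x] by (intro equalityI) (auto dest: sub)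
    qed
  qed
  ultimately show ?thesis unfolding lie_isomorphic_def by blast
qed

section \<open>Eigenspaces of commuting operators of finite order\<close>

text \<open>Divide the exponent by m: the multiple of m contributes 1, and minimality of the order
  forces the remainder to be 0.\<close>

lemma primitive_root_powi_eq_iff:
  assumes "primitive_root m \<xi>"
  shows "\<xi> powi k = \<xi> powi l \<longleftrightarrow> int m dvd k - l"
proof -
  have m: "0 < m" "\<xi> ^ m = 1" and least: "\<And>j. 0 < j \<Longrightarrow> j < m \<Longrightarrow> \<xi> ^ j \<noteq> 1"
    using assms by (auto simp: primitive_root_def)
  have nz: "\<xi> \<noteq> 0" using m by (auto simp: power_0_left split: if_splits)
  have "\<xi> powi d = 1 \<longleftrightarrow> int m dvd d" for d
  proof -
    define q r where "q = d div int m" and "r = d mod int m"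
    have r: "0 \<le> r" "r < int m" using m(1) by (simp_all add: r_def)
    have "\<xi> powi d = \<xi> powi (int m * q + r)" by (simp add: q_def r_def)
    also have "\<dots> = \<xi> powi (int m * q) * \<xi> powi r" using nz by (simp add: power_int_add)
    also have "\<dots> = \<xi> ^ nat r" using r(1) by (simp add: power_int_mult m(2)) (simp add: power_int_def)
    finally have "\<xi> powi d = \<xi> ^ nat r" .
    moreover have "\<xi> ^ nat r = 1 \<longleftrightarrow> r = 0" using least[of "nat r"] r by (cases "r = 0") auto
    ultimately show ?thesis by (simp add: r_def dvd_eq_mod_eq_0)
  qed
  moreover have "\<xi> powi k = \<xi> powi l \<longleftrightarrow> \<xi> powi (k - l) = 1"
    using nz by (simp add: power_int_diff)
  ultimately show ?thesis by simp
qed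

lemma sum_cyclic_shift:
  fixes g :: "nat \<Rightarrow> 'a::ab_group_add"
  assumes "g m = g 0"
  shows "(\<Sum>s<m. g (Suc s)) = (\<Sum>s<m. g s)"
  using sum.lessThan_Suc_shift[of g m] assms by simp

lemmas linear_map_simps =
  module_hom.add[OF Vector_Spaces.module_hom_linearI]
  module_hom.diff[OF Vector_Spaces.module_hom_linearI]
  module_hom.zero[OF Vector_Spaces.module_hom_linearI]
  module_hom.scale[OF Vector_Spaces.module_hom_linearI]
  module_hom.sum[OF Vector_Spaces.module_hom_linearI]

context complex_lie_algebra
begin

lemma linear_commute_funpow:
  assumes "\<And>x. S (T x) = T (S x)"
  shows "S ((T ^^ n) x) = (T ^^ n) (S x)"
  by (induction n) (simp_all add: assms)

text \<open>\<open>Y r\<close> is the discrete Fourier projection of X, the average of \<xi>^{-rs}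
  T^s X over s < m. Being a polynomial in T applied to X, it inherits the eigenvalues of X under
  operators commuting with T; this last clause permits diagonalising several operators in
  succession.\<close>

lemma finite_order_eigen_decomposition:
  assumes T: "Vector_Spaces.linear sc sc T" and T_m: "T ^^ m = id"
    and \<xi>: "primitive_root m \<xi>"
  obtains Y where "(\<Sum>r<m. Y r) = X" "\<And>r. T (Y r) = sc (\<xi> ^ r) (Y r)"
    "\<And>S c r. Vector_Spaces.linear sc sc S \<Longrightarrow> S \<circ> T = T \<circ> S \<Longrightarrow> S X = sc c X \<Longrightarrow>
      S (Y r) = sc c (Y r)"
proof
  define \<zeta> where "\<zeta> = inverse \<xi>"
  define Y where "Y r = sc (1 / of_nat m) (\<Sum>s<m. sc ((\<zeta> ^ r) ^ s) ((T ^^ s) X))" for r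
  have m: "0 < m" "\<xi> ^ m = 1" and least: "\<And>j. 0 < j \<Longrightarrow> j < m \<Longrightarrow> \<xi> ^ j \<noteq> 1"
    using \<xi> by (auto simp: primitive_root_def)
  have nz: "\<xi> \<noteq> 0" using m by (auto simp: power_0_left split: if_splits)
  have \<zeta>: "\<zeta> ^ m = 1" by (simp add: \<zeta>_def m power_inverse)
  have \<zeta>1: "\<zeta> ^ s \<noteq> 1" if "0 < s" "s < m" for s
    using least[OF that] by (simp add: \<zeta>_def power_inverse)
  \<comment> \<open>Orthogonality of characters: for 0 < s < m the number \<open>\<zeta> ^ s\<close>
    is an m-th root of unity other than 1, so the geometric sum of its powers vanishes.\<close>
  have roots: "(\<Sum>r<m. (\<zeta> ^ r) ^ s) = (if s = 0 then of_nat m else 0)" if "s < m" for s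
  proof (cases "s = 0")
    case False
    have "(1 - \<zeta> ^ s) * (\<Sum>r<m. (\<zeta> ^ s) ^ r) = 1 - (\<zeta> ^ s) ^ m"
      by (simp add: one_diff_power_eq)
    also have "\<dots> = 0" by (metis \<zeta> power_mult mult.commute power_one diff_self)
    finally have "(\<Sum>r<m. (\<zeta> ^ s) ^ r) = 0" using \<zeta>1[of s] False that by simp
    then show ?thesis using False by (simp add: power_mult[symmetric] mult.commute)
  qed simp
  have "(\<Sum>r<m. Y r) = sc (1 / of_nat m) (\<Sum>r<m. \<Sum>s<m. sc ((\<zeta> ^ r) ^ s) ((T ^^ s) X))"
    by (simp add: Y_def scale_sum_right)
  also have "(\<Sum>r<m. \<Sum>s<m. sc ((\<zeta> ^ r) ^ s) ((T ^^ s) X))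
      = (\<Sum>s<m. sc (\<Sum>r<m. (\<zeta> ^ r) ^ s) ((T ^^ s) X))"
    by (subst sum.swap) (simp add: scale_sum_left)
  also have "\<dots> = (\<Sum>s<m. if s = 0 then sc (of_nat m) X else 0)"
    by (intro sum.cong refl) (auto simp: roots)
  also have "\<dots> = sc (of_nat m) X" using m by simp
  finally show "(\<Sum>r<m. Y r) = X" using m by simp
  note T = linear_map_simps[OF T]
  show "T (Y r) = sc (\<xi> ^ r) (Y r)" for r
  proof -
    let ?g = "\<lambda>s. sc ((\<zeta> ^ r) ^ s) ((T ^^ s) X)"
    \<comment> \<open>T raises the power of T to \<open>Suc s\<close> while the weight lags behind
      by one factor \<open>\<zeta> ^ r\<close>; the compensating factor \<open>\<xi> ^ r\<close> is
      the eigenvalue.\<close>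
    have step: "sc ((\<zeta> ^ r) ^ s) (T ((T ^^ s) X)) = sc (\<xi> ^ r) (?g (Suc s))" for s
    proof -
      have "\<xi> ^ r * \<zeta> ^ r = 1" using nz by (simp add: \<zeta>_def power_mult_distrib[symmetric])
      then have "\<xi> ^ r * (\<zeta> ^ r) ^ Suc s = (\<zeta> ^ r) ^ s" by (simp add: mult.assoc[symmetric])
      then show ?thesis by simp
    qed
    have "(\<zeta> ^ r) ^ m = 1" by (metis \<zeta> power_mult mult.commute power_one)
    then have shift: "(\<Sum>s<m. ?g (Suc s)) = (\<Sum>s<m. ?g s)"
      by (intro sum_cyclic_shift) (simp add: T_m)
    have "T (Y r) = sc (1 / of_nat m) (\<Sum>s<m. sc (\<xi> ^ r) (?g (Suc s)))"
      by (simp only: Y_def T(4,5) step)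
    also have "\<dots> = sc (\<xi> ^ r) (sc (1 / of_nat m) (\<Sum>s<m. ?g (Suc s)))"
      by (simp only: scale_sum_right[symmetric] scale_left_commute)
    finally show ?thesis by (simp only: shift Y_def)
  qed
  fix S c r
  assume S: "Vector_Spaces.linear sc sc S" and ST: "S \<circ> T = T \<circ> S" and SX: "S X = sc c X"
  note S = linear_map_simps[OF S]
  have "(T ^^ s) (sc c X) = sc c ((T ^^ s) X)" for s
    by (induction s) (simp_all add: T(4))
  then have "S ((T ^^ s) X) = sc c ((T ^^ s) X)" for s
    using linear_commute_funpow[of S T] ST SX by (metis comp_apply)
  then show "S (Y r) = sc c (Y r)"
    by (simp add: Y_def S(4,5) scale_sum_right mult_ac)
qed

end

section \<open>Evaluation of the multiloop algebra\<close>

locale multiloop = complex_lie_algebra sc br + point_grid m a Ns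
  for sc :: "complex \<Rightarrow> 'g::ab_group_add \<Rightarrow> 'g" and br :: "'g \<Rightarrow> 'g \<Rightarrow> 'g"
    and m :: "'n::finite \<Rightarrow> nat" and a :: "'n \<Rightarrow> nat \<Rightarrow> complex" and Ns :: "'n \<Rightarrow> nat" +
  fixes B :: "'g \<Rightarrow> 'g \<Rightarrow> complex"
    and \<sigma>0 :: "'g \<Rightarrow> 'g" and \<sigma> :: "'n \<Rightarrow> 'g \<Rightarrow> 'g"
    and \<xi>0 :: complex and \<xi> :: "'n \<Rightarrow> complex"
  assumes form: "invariant_form sc br B"
    and \<sigma>0_linear: "Vector_Spaces.linear sc sc \<sigma>0"
    and \<sigma>_linear: "\<And>i. Vector_Spaces.linear sc sc (\<sigma> i)"
    and \<sigma>0_commute: "\<And>i. \<sigma>0 \<circ> \<sigma> i = \<sigma> i \<circ> \<sigma>0"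
    and \<sigma>_commute: "\<And>i j. \<sigma> i \<circ> \<sigma> j = \<sigma> j \<circ> \<sigma> i"
    and \<sigma>_order: "\<And>i. \<sigma> i ^^ m i = id"
    and \<xi>_primitive: "\<And>i. primitive_root (m i) (\<xi> i)"
begin

abbreviation G where "G \<equiv> joint_eigenspace sc \<sigma>0 \<sigma> \<xi>0 \<xi>"
abbreviation E where "E \<equiv> eigenspace sc \<sigma>0 \<xi>0"

lemmas \<sigma>0_simps = linear_map_simps[OF \<sigma>0_linear]
lemmas \<sigma>_simps = linear_map_simps[OF \<sigma>_linear]

section \<open>Joint eigenspaces: spanning and independence\<close>

lemma G_subspace: "subspace (G k0 k)"
  by (rule subspaceI) (auto simp: joint_eigenspace_def \<sigma>0_simps \<sigma>_simps scale_right_distrib mult.commute)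

lemma E_subspace: "subspace (E k0)"
  by (rule subspaceI) (auto simp: eigenspace_def \<sigma>0_simps scale_right_distrib mult.commute)

lemma G_subset_E: "G k0 k \<subseteq> E k0"
  by (auto simp: joint_eigenspace_def eigenspace_def)

lemma \<xi>_powi_eq_iff: "\<xi> i powi k = \<xi> i powi l \<longleftrightarrow> int (m i) dvd k - l"
  by (rule primitive_root_powi_eq_iff[OF \<xi>_primitive])

lemma G_cong: "k - l \<in> Gam m \<Longrightarrow> G k0 k = G k0 l"
proof -
  assume "k - l \<in> Gam m"
  then have "\<xi> i powi (k $ i) = \<xi> i powi (l $ i)" for i
    by (simp add: \<xi>_powi_eq_iff Gam_def)
  then show ?thesis by (simp add: joint_eigenspace_def)
qed

text \<open>Induction on the set F of coordinates whose automorphisms already act by scalars. The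
  projections for the next \<open>\<sigma> i\<close> split a vector into eigenvectors, and
  commutation keeps the eigenvalues for \<open>\<sigma>0\<close> and for F.\<close>

lemma E_span: "E k0 \<subseteq> span (\<Union>k. G k0 k)"
proof -
  define P where "P F = {X \<in> E k0. \<forall>i\<in>F. \<exists>r::int. \<sigma> i X = sc (\<xi> i powi r) X}" for F
  have "E k0 \<subseteq> span (P F)" if "finite F" for F
    using that
  proof induction
    case empty
    then show ?case by (auto simp: P_def intro: span_base)
  next
    case (insert i F)
    have "X \<in> span (P (insert i F))" if X: "X \<in> P F" for X
    proof -
      obtain Y where sum: "(\<Sum>r<m i. Y r) = X" and Y: "\<And>r. \<sigma> i (Y r) = sc (\<xi> i ^ r) (Y r)"
        and inh: "\<And>S c r. Vector_Spaces.linear sc sc S \<Longrightarrow> S \<circ> \<sigma> i = \<sigma> i \<circ> S \<Longrightarrow> S X = sc c X \<Longrightarrow>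
          S (Y r) = sc c (Y r)"
        using finite_order_eigen_decomposition[OF \<sigma>_linear \<sigma>_order \<xi>_primitive, of i X] by metis
      have "Y r \<in> P (insert i F)" for r
      proof -
        have "Y r \<in> E k0"
          using X inh[OF \<sigma>0_linear \<sigma>0_commute] by (auto simp: P_def eigenspace_def)
        moreover have "\<exists>d::int. \<sigma> i (Y r) = sc (\<xi> i powi d) (Y r)"
          using Y[of r] by (metis power_int_of_nat)
        moreover have "\<exists>d::int. \<sigma> j (Y r) = sc (\<xi> j powi d) (Y r)" if "j \<in> F" for j
          using X that inh[OF \<sigma>_linear \<sigma>_commute] by (fastforce simp: P_def)
        ultimately show ?thesis by (auto simp: P_def)
      qed
      then show ?thesis unfolding sum[symmetric] by (intro span_sum span_base)
    qed
    then have "span (P F) \<subseteq> span (P (insert i F))" by (intro span_minimal subspace_span) auto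
    with insert.IH show ?case by auto
  qed
  then have "E k0 \<subseteq> span (P UNIV)" by simp
  also have "P UNIV \<subseteq> (\<Union>k. G k0 k)"
  proof
    fix X assume X: "X \<in> P UNIV"
    then obtain r where "\<And>i. \<sigma> i X = sc (\<xi> i powi r i) X" unfolding P_def by auto metis
    with X have "X \<in> G k0 (\<chi> i. r i)" by (auto simp: P_def joint_eigenspace_def eigenspace_def)
    then show "X \<in> (\<Union>k. G k0 k)" by blast
  qed
  then have "span (P UNIV) \<subseteq> span (\<Union>k. G k0 k)" by (rule span_mono)
  finally show ?thesis .
qed

text \<open>T is a product of operators \<open>\<sigma> i - \<xi> i powi (q $ i)\<close>, one for
  each q in Q, where i is a coordinate in which q and r differ modulo \<open>m i\<close>. Each acts
  on every joint eigenspace by a scalar, which is 0 in degree q and nonzero in degree r.\<close>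

lemma separating_operator:
  assumes "finite Q" "\<And>k. k \<in> Q \<Longrightarrow> k - r \<notin> Gam m"
  shows "\<exists>T c. Vector_Spaces.linear sc sc T \<and> c \<noteq> 0 \<and>
    (\<forall>k0. \<forall>X\<in>G k0 r. T X = sc c X) \<and> (\<forall>k0. \<forall>k\<in>Q. \<forall>X\<in>G k0 k. T X = 0)"
  using assms
proof (induction)
  case empty
  show ?case
    by (intro exI[of _ "\<lambda>x. x"] exI[of _ 1]) (auto simp: Vector_Spaces.linear_iff vector_space_axioms)
next
  case (insert q Q)
  have "\<exists>T c. Vector_Spaces.linear sc sc T \<and> c \<noteq> 0 \<and>
    (\<forall>k0. \<forall>X\<in>G k0 r. T X = sc c X) \<and> (\<forall>k0. \<forall>k\<in>Q. \<forall>X\<in>G k0 k. T X = 0)"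
    by (rule insert.IH) (use insert.prems in blast)
  then obtain T c where T: "Vector_Spaces.linear sc sc T" and c: "c \<noteq> 0"
    and T_r: "\<forall>k0. \<forall>X\<in>G k0 r. T X = sc c X"
    and T_Q: "\<forall>k0. \<forall>k\<in>Q. \<forall>X\<in>G k0 k. T X = 0"
    by (elim exE conjE)
  note T_simps = linear_map_simps[OF T]
  obtain i where i: "\<not> int (m i) dvd q $ i - r $ i"
    using insert.prems[of q] by (auto simp: Gam_def)
  define S where "S X = T (\<sigma> i X - sc (\<xi> i powi (q $ i)) X)" for X
  have "Vector_Spaces.linear sc sc S"
    unfolding Vector_Spaces.linear_iff
    by (simp add: S_def \<sigma>_simps T_simps vector_space_axioms scale_right_distrib
        scale_right_diff_distrib mult.commute)
  moreover have S_eigen: "S X = sc (\<xi> i powi (k $ i) - \<xi> i powi (q $ i)) (T X)" if "X \<in> G k0 k" for X k0 k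
    using that by (simp add: S_def joint_eigenspace_def T_simps scale_left_diff_distrib)
  moreover have "\<xi> i powi (r $ i) - \<xi> i powi (q $ i) \<noteq> 0"
    using i \<xi>_powi_eq_iff[of i "q $ i" "r $ i"] by auto
  ultimately show ?case
    using c T_r T_Q
    by (intro exI[of _ S] exI[of _ "(\<xi> i powi (r $ i) - \<xi> i powi (q $ i)) * c"]) auto
qed

text \<open>The separating operator multiplies the class of r by c and kills the other degrees in Q.
  Degrees congruent to r share one eigenspace, so only the sum over the class can be concluded to
  vanish, not its single terms.\<close>

lemma G_independent:
  assumes "finite Q" and Y: "\<And>k. k \<in> Q \<Longrightarrow> Y k \<in> G k0 k" and zero: "(\<Sum>k\<in>Q. Y k) = 0"
  shows "(\<Sum>k\<in>{k \<in> Q. k - r \<in> Gam m}. Y k) = 0"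
proof -
  have "\<exists>T c. Vector_Spaces.linear sc sc T \<and> c \<noteq> 0 \<and> (\<forall>k0. \<forall>X\<in>G k0 r. T X = sc c X) \<and>
    (\<forall>k0. \<forall>k\<in>{k \<in> Q. k - r \<notin> Gam m}. \<forall>X\<in>G k0 k. T X = 0)"
    by (rule separating_operator) (use assms(1) in auto)
  then obtain T c where T: "Vector_Spaces.linear sc sc T" and c: "c \<noteq> 0"
    and T_r: "\<forall>k0. \<forall>X\<in>G k0 r. T X = sc c X"
    and T_Q: "\<forall>k0. \<forall>k\<in>{k \<in> Q. k - r \<notin> Gam m}. \<forall>X\<in>G k0 k. T X = 0"
    by (elim exE conjE)
  have "0 = T (\<Sum>k\<in>Q. Y k)" by (simp add: zero linear_map_simps[OF T])
  also have "\<dots> = (\<Sum>k\<in>Q. if k - r \<in> Gam m then sc c (Y k) else 0)"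
    unfolding linear_map_simps[OF T]
  proof (intro sum.cong refl)
    fix k assume k: "k \<in> Q"
    show "T (Y k) = (if k - r \<in> Gam m then sc c (Y k) else 0)"
    proof (cases "k - r \<in> Gam m")
      case True
      then show ?thesis using T_r Y[OF k] G_cong[OF True, of k0] by simp
    next
      case False
      then show ?thesis using T_Q Y[OF k] k by auto
    qed
  qed
  also have "\<dots> = sc c (\<Sum>k\<in>{k \<in> Q. k - r \<in> Gam m}. Y k)"
    by (simp add: sum.If_cases assms(1) Int_def scale_sum_right)
  finally show ?thesis using c by simp
qed

section \<open>Evaluation at one grid point and its compatibility with the brackets\<close>

definition eval_loop :: "('n \<Rightarrow> nat) \<Rightarrow> (int \<times> (int ^ 'n) \<Rightarrow>\<^sub>0 'g) \<Rightarrow> (int \<Rightarrow>\<^sub>0 'g)" where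
  "eval_loop \<iota> = psum (\<lambda>p x. Poly_Mapping.single (fst p) (sc (point_pow a \<iota> (snd p)) x))"

lemma additive_sc: "Modules.additive (sc c)" "Modules.additive (\<lambda>c. sc c x)"
  by (simp_all add: Modules.additive_def scale_right_distrib scale_left_distrib)

text \<open>Evaluation is defined on all finitely supported functions, so identities may be tested
  on singles with arbitrary coefficients, inside an eigenspace or not.\<close>

lemma additive_eval_loop: "Modules.additive (eval_loop \<iota>)"
  unfolding eval_loop_def
  by (intro additive_psum additive_compose[OF additive_single] additive_sc)

lemma eval_loop_single:
  "eval_loop \<iota> (Poly_Mapping.single (k0, k) x) = Poly_Mapping.single k0 (sc (point_pow a \<iota> k) x)"
  unfolding eval_loop_def
  by (simp add: psum_single additive_compose[OF additive_single] additive_sc)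

lemmas eval_loop_simps =
  Modules.additive.add[OF additive_eval_loop] Modules.additive.diff[OF additive_eval_loop]
  Modules.additive.zero[OF additive_eval_loop] Modules.additive.sum[OF additive_eval_loop]
  eval_loop_single

lemma ev_map_eq:
  "ev_map sc a N I x = (\<lambda>j\<in>{1..N}. (eval_loop (I j) (fst x), laurent_eval a (I j) (snd x)))"
  by (cases x) (simp add: ev_map_def eval_loop_def laurent_eval_def psum_def split_def)

lemma map_sc_single:
  "Poly_Mapping.map (sc z) (Poly_Mapping.single k x) = Poly_Mapping.single k (sc z x)"
  by (intro map_single) simp

lemmas additive_map_sc = additive_map[OF additive_sc(1)]

lemma eval_loop_scale: "eval_loop \<iota> (Poly_Mapping.map (sc z) f) = Poly_Mapping.map (sc z) (eval_loop \<iota> f)"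
  by (rule additive_eqI[where f = f, OF additive_compose[OF additive_eval_loop additive_map_sc]
        additive_compose[OF additive_map_sc additive_eval_loop]])
    (auto simp: map_sc_single eval_loop_single mult.commute)

lemma laurent_eval_scale: "laurent_eval a \<iota> (Poly_Mapping.map ((*) z) p) = z * laurent_eval a \<iota> p"
proof (rule additive_eqI[where f = p])
  show "Modules.additive (\<lambda>p. laurent_eval a \<iota> (Poly_Mapping.map ((*) z) p))"
    by (intro additive_compose[OF additive_laurent_eval] additive_map)
      (simp add: Modules.additive_def distrib_left)
  show "Modules.additive (\<lambda>p. z * laurent_eval a \<iota> p)"
    by (simp add: Modules.additive_def laurent_eval_simps distrib_left)
qed (simp add: laurent_eval_single)

lemma br_additive: "Modules.additive (br x)" "Modules.additive (\<lambda>x. br x y)"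
  using linear_map_simps(1)[OF linear_right] linear_map_simps(1)[OF linear_left]
  by (auto simp: Modules.additive_def)

lemma br_scale: "br (sc c x) y = sc c (br x y)" "br x (sc c y) = sc c (br x y)"
  using linear_map_simps(4)[OF linear_right] linear_map_simps(4)[OF linear_left] by auto

lemma B_linear: "Vector_Spaces.linear sc (*) (B x)" and B_sym: "B x y = B y x"
  using form by (auto simp: invariant_form_def)

lemma B_additive: "Modules.additive (B x)" "Modules.additive (\<lambda>x. B x y)"
  using linear_map_simps(1)[OF B_linear] B_sym by (auto simp: Modules.additive_def)

lemma B_scale: "B (sc c x) y = c * B x y" "B x (sc c y) = c * B x y"
  using linear_map_simps(4)[OF B_linear] B_sym by metis+

text \<open>Each bracket is split into a loop and a central component. Both depend only on the loop
  components of the arguments, K being central, and both are biadditive, so pairs of monomials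
  suffice to compare them.\<close>

definition "loop_br1 = bipsum (\<lambda>(k0, k :: int ^ 'n) x (l0, l) y. Poly_Mapping.single (k0 + l0 :: int, k + l) (br x y))"
definition "loop_br2 = bipsum (\<lambda>(k0 :: int, k :: int ^ 'n) x (l0, l) y. Poly_Mapping.single (k + l)
  (if k0 + l0 = 0 then B x y * of_int k0 else 0))"
definition "affine_br1 = bipsum (\<lambda>k x l y. Poly_Mapping.single (k + l :: int) (br x y))"
definition "affine_br2 = bipsum (\<lambda>k x l y. if k + l = (0 :: int) then B x y * of_int k else 0)"

lemma loop_bracket_eq: "loop_bracket br B x y = (loop_br1 (fst x) (fst y), loop_br2 (fst x) (fst y))"
  by (cases x; cases y)
    (simp add: loop_bracket_def loop_br1_def loop_br2_def bipsum_def psum_def split_def cong: if_cong)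

lemma affine_bracket_eq:
  "affine_bracket br B x y = (affine_br1 (fst x) (fst y), affine_br2 (fst x) (fst y))"
  by (cases x; cases y)
    (simp add: affine_bracket_def affine_br1_def affine_br2_def bipsum_def psum_def split_def cong: if_cong)

lemma bracket_additive:
  "Modules.additive (\<lambda>y. Poly_Mapping.single k (br x y))"
  "Modules.additive (\<lambda>x. Poly_Mapping.single k (br x y))"
  "Modules.additive (\<lambda>y. if P then B x y * c else 0)"
  "Modules.additive (\<lambda>x. if P then B x y * c else 0)"
  "Modules.additive (\<lambda>y. Poly_Mapping.single k (if P then B x y * c else 0))"
  "Modules.additive (\<lambda>x. Poly_Mapping.single k (if P then B x y * c else 0))"
proof -
  show 3: "Modules.additive (\<lambda>y. if P then B x y * c else 0)" for x
    using Modules.additive.add[OF B_additive(1)] by (simp add: Modules.additive_def algebra_simps)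
  show 4: "Modules.additive (\<lambda>x. if P then B x y * c else 0)" for y
    using Modules.additive.add[OF B_additive(2)] by (simp add: Modules.additive_def algebra_simps)
  show "Modules.additive (\<lambda>y. Poly_Mapping.single k (if P then B x y * c else 0))"
    "Modules.additive (\<lambda>x. Poly_Mapping.single k (if P then B x y * c else 0))"
    by (rule additive_compose[OF additive_single 3] additive_compose[OF additive_single 4])+
qed (rule additive_compose[OF additive_single br_additive(1)]
    additive_compose[OF additive_single br_additive(2)])+

lemma br_maps_additive:
  "Modules.additive (loop_br1 f)" "Modules.additive (\<lambda>f. loop_br1 f g)"
  "Modules.additive (loop_br2 f)" "Modules.additive (\<lambda>f. loop_br2 f g)"
  "Modules.additive (affine_br1 f')" "Modules.additive (\<lambda>f. affine_br1 f g')"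
  "Modules.additive (affine_br2 f')" "Modules.additive (\<lambda>f. affine_br2 f g')"
  unfolding loop_br1_def loop_br2_def affine_br1_def affine_br2_def split_def
  by (intro additive_bipsum_left additive_bipsum_right bracket_additive)+

lemma br_maps_single:
  "loop_br1 (Poly_Mapping.single (k0, k) x) (Poly_Mapping.single (l0, l) y) =
    Poly_Mapping.single (k0 + l0, k + l) (br x y)"
  "loop_br2 (Poly_Mapping.single (k0, k) x) (Poly_Mapping.single (l0, l) y) =
    Poly_Mapping.single (k + l) (if k0 + l0 = 0 then B x y * of_int k0 else 0)"
  "affine_br1 (Poly_Mapping.single k0 x) (Poly_Mapping.single l0 y) =
    Poly_Mapping.single (k0 + l0) (br x y)"
  "affine_br2 (Poly_Mapping.single k0 x) (Poly_Mapping.single l0 y) =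
    (if k0 + l0 = 0 then B x y * of_int k0 else 0)"
  unfolding loop_br1_def loop_br2_def affine_br1_def affine_br2_def split_def
  by (subst bipsum_single; (intro bracket_additive)?; simp)+

lemma eval_loop_br1:
  assumes "\<iota> \<in> multi_indices Ns"
  shows "eval_loop \<iota> (loop_br1 f g) = affine_br1 (eval_loop \<iota> f) (eval_loop \<iota> g)"
proof (rule biadditive_eqI[where F = "\<lambda>f g. eval_loop \<iota> (loop_br1 f g)"
      and G = "\<lambda>f g. affine_br1 (eval_loop \<iota> f) (eval_loop \<iota> g)"])
  fix k l :: "int \<times> (int ^ 'n)" and x y
  show "eval_loop \<iota> (loop_br1 (Poly_Mapping.single k x) (Poly_Mapping.single l y)) =
    affine_br1 (eval_loop \<iota> (Poly_Mapping.single k x)) (eval_loop \<iota> (Poly_Mapping.single l y))"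
    by (cases k; cases l)
      (simp add: br_maps_single eval_loop_single point_pow_add[OF assms] br_scale mult.commute)
  show "Modules.additive (\<lambda>g. eval_loop \<iota> (loop_br1 f g))" for f
    by (rule additive_compose[OF additive_eval_loop br_maps_additive(1)])
  show "Modules.additive (\<lambda>f. eval_loop \<iota> (loop_br1 f g))" for g
    by (rule additive_compose[OF additive_eval_loop br_maps_additive(2)])
  show "Modules.additive (\<lambda>g. affine_br1 (eval_loop \<iota> f) (eval_loop \<iota> g))" for f
    by (rule additive_compose[OF br_maps_additive(5) additive_eval_loop])
  show "Modules.additive (\<lambda>f. affine_br1 (eval_loop \<iota> f) (eval_loop \<iota> g))" for g
    by (rule additive_compose[OF br_maps_additive(6) additive_eval_loop])
qed

text \<open>Evaluation leaves the exponents of t_0 alone, so the condition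
  \<open>k0 + l0 = 0\<close> and the factor \<open>k0\<close> match; the rest is a^{k+l} = a^k a^l
  and bilinearity of \<open>B\<close>.\<close>

lemma laurent_eval_br2:
  assumes "\<iota> \<in> multi_indices Ns"
  shows "laurent_eval a \<iota> (loop_br2 f g) = affine_br2 (eval_loop \<iota> f) (eval_loop \<iota> g)"
proof (rule biadditive_eqI[where F = "\<lambda>f g. laurent_eval a \<iota> (loop_br2 f g)"
      and G = "\<lambda>f g. affine_br2 (eval_loop \<iota> f) (eval_loop \<iota> g)"])
  fix k l :: "int \<times> (int ^ 'n)" and x y
  show "laurent_eval a \<iota> (loop_br2 (Poly_Mapping.single k x) (Poly_Mapping.single l y)) =
    affine_br2 (eval_loop \<iota> (Poly_Mapping.single k x)) (eval_loop \<iota> (Poly_Mapping.single l y))"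
    by (cases k; cases l)
      (simp add: br_maps_single eval_loop_single laurent_eval_simps point_pow_add[OF assms] B_scale mult_ac)
  show "Modules.additive (\<lambda>g. laurent_eval a \<iota> (loop_br2 f g))" for f
    by (rule additive_compose[OF additive_laurent_eval br_maps_additive(3)])
  show "Modules.additive (\<lambda>f. laurent_eval a \<iota> (loop_br2 f g))" for g
    by (rule additive_compose[OF additive_laurent_eval br_maps_additive(4)])
  show "Modules.additive (\<lambda>g. affine_br2 (eval_loop \<iota> f) (eval_loop \<iota> g))" for f
    by (rule additive_compose[OF br_maps_additive(7) additive_eval_loop])
  show "Modules.additive (\<lambda>f. affine_br2 (eval_loop \<iota> f) (eval_loop \<iota> g))" for g
    by (rule additive_compose[OF br_maps_additive(8) additive_eval_loop])
qed

section \<open>The ideal L'(I') and the kernel of evaluation\<close>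

definition loop_carrier :: "(int \<times> (int ^ 'n) \<Rightarrow>\<^sub>0 'g) set" where
  "loop_carrier = {f. \<forall>k0 k. Poly_Mapping.lookup f (k0, k) \<in> G k0 k}"

lemma loop_carrier_simps:
  shows "0 \<in> loop_carrier"
    and "f \<in> loop_carrier \<Longrightarrow> g \<in> loop_carrier \<Longrightarrow> f + g \<in> loop_carrier"
    and "f \<in> loop_carrier \<Longrightarrow> g \<in> loop_carrier \<Longrightarrow> f - g \<in> loop_carrier"
    and "f \<in> loop_carrier \<Longrightarrow> Poly_Mapping.map (sc z) f \<in> loop_carrier"
    and "X \<in> G k0 k \<Longrightarrow> Poly_Mapping.single (k0, k) X \<in> loop_carrier"
  using G_subspace
  by (auto simp: loop_carrier_def lookup_add lookup_minus lookup_map_scale lookup_single when_def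
      subspace_0 subspace_add subspace_diff subspace_scale)

lemma loop_carrier_sum:
  "(\<And>x. x \<in> S \<Longrightarrow> f x \<in> loop_carrier) \<Longrightarrow> sum f S \<in> loop_carrier"
  by (induction S rule: infinite_finite_induct) (auto simp: loop_carrier_simps)

definition lterm :: "int \<Rightarrow> int ^ 'n \<Rightarrow> 'g \<Rightarrow> ((int ^ 'n) \<Rightarrow>\<^sub>0 complex) \<Rightarrow> (int \<times> (int ^ 'n) \<Rightarrow>\<^sub>0 'g)"
  where "lterm k0 k X = psum (\<lambda>l c. Poly_Mapping.single (k0, k + l) (sc c X))"

lemma loop_term_eq: "loop_term sc X k0 k p = (lterm k0 k X p, 0)"
  by (simp add: loop_term_def lterm_def psum_def)

lemma additive_lterm: "Modules.additive (lterm k0 k X)" "Modules.additive (\<lambda>X. lterm k0 k X p)"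
  unfolding lterm_def
  by (intro additive_psum additive_compose[OF additive_single additive_sc(2)])
    (intro additive_psum_param additive_compose[OF additive_single additive_sc(1)])

lemma lterm_single:
  "lterm k0 k X (Poly_Mapping.single l c) = Poly_Mapping.single (k0, k + l) (sc c X)"
  unfolding lterm_def
  by (rule psum_single[OF additive_compose[OF additive_single additive_sc(2)]])

text \<open>Once constants are moved from the Laurent factor to X, terms sharing the factor
  \<open>idem \<iota>\<close> can be added inside the Lie algebra.\<close>

lemma lterm_scale: "lterm k0 k X (Poly_Mapping.single 0 c * p) = lterm k0 k (sc c X) p"
proof (rule additive_eqI[where F = "\<lambda>p. lterm k0 k X (Poly_Mapping.single 0 c * p)" and f = p])
  show "Modules.additive (\<lambda>p. lterm k0 k X (Poly_Mapping.single 0 c * p))"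
    by (simp add: Modules.additive_def distrib_left Modules.additive.add[OF additive_lterm(1)])
qed (simp_all add: additive_lterm(1) mult_single lterm_single mult.commute)

lemma eval_loop_lterm:
  assumes "\<iota> \<in> multi_indices Ns"
  shows "eval_loop \<iota> (lterm k0 k X p) =
    Poly_Mapping.single k0 (sc (point_pow a \<iota> k * laurent_eval a \<iota> p) X)"
proof (rule additive_eqI[where F = "\<lambda>p. eval_loop \<iota> (lterm k0 k X p)" and f = p])
  show "Modules.additive (\<lambda>p. eval_loop \<iota> (lterm k0 k X p))"
    by (rule additive_compose[OF additive_eval_loop additive_lterm(1)])
  show "Modules.additive (\<lambda>p. Poly_Mapping.single k0 (sc (point_pow a \<iota> k * laurent_eval a \<iota> p) X))"
    by (simp add: Modules.additive_def laurent_eval_simps distrib_left scale_left_distrib single_add)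
qed (simp add: lterm_single eval_loop_single laurent_eval_single point_pow_add[OF assms] mult_ac)

lemma G_Gam: "l \<in> Gam m \<Longrightarrow> G k0 (k + l) = G k0 k"
  by (rule G_cong) simp

lemma lterm_carrier:
  assumes "X \<in> G k0 k" "p \<in> laurent_sub m"
  shows "lterm k0 k X p \<in> loop_carrier"
  unfolding lterm_def psum_def
  using assms G_subspace
  by (intro loop_carrier_sum loop_carrier_simps(5)) (auto simp: laurent_sub_def G_Gam subspace_scale)

lemma loop_scale_eq:
  "loop_scale sc z x = (Poly_Mapping.map (sc z) (fst x), Poly_Mapping.map ((*) z) (snd x))"
  by (simp add: loop_scale_def split_def)

lemma module_loop_scale:
  "module (loop_scale sc :: complex \<Rightarrow> ('g, 'n) loop_elt \<Rightarrow> ('g, 'n) loop_elt)"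
proof (rule module.intro)
  show "loop_scale sc c (x + y) = loop_scale sc c x + loop_scale sc c y"
    "loop_scale sc (c + d) x = loop_scale sc c x + loop_scale sc d x"
    "loop_scale sc c (loop_scale sc d x) = loop_scale sc (c * d) x"
    "loop_scale sc 1 x = x"
    for c d and x y :: "('g, 'n) loop_elt"
    by (auto intro!: prod_eqI poly_mapping_eqI simp: loop_scale_eq lookup_map_scale lookup_add
        scale_right_distrib scale_left_distrib distrib_left distrib_right)
qed

abbreviation J where "J \<equiv> loop_ideal sc G I'"

lemma J_0: "0 \<in> J"
  and J_add: "x \<in> J \<Longrightarrow> y \<in> J \<Longrightarrow> x + y \<in> J"
  and J_sum: "(\<And>i. i \<in> S \<Longrightarrow> g i \<in> J) \<Longrightarrow> sum g S \<in> J"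
  and J_lterm: "X \<in> G k0 k \<Longrightarrow> p \<in> I' \<Longrightarrow> (lterm k0 k X p, 0) \<in> J"
  and J_central: "p \<in> I' \<Longrightarrow> (0, p) \<in> J"
  unfolding loop_ideal_def loop_term_eq
proof -
  note m = module_loop_scale
  let ?S = "{(lterm k0 k X p, 0) |X k0 k p. X \<in> G k0 k \<and> p \<in> I'} \<union> {(0, p) |p. p \<in> I'}"
  let ?J = "module.span (loop_scale sc) ?S"
  show "0 \<in> ?J" by (rule module.span_zero[OF m])
  show "x + y \<in> ?J" if "x \<in> ?J" "y \<in> ?J" by (rule module.span_add[OF m that])
  show "sum g S \<in> ?J" if "\<And>i. i \<in> S \<Longrightarrow> g i \<in> ?J" by (rule module.span_sum[OF m that])
  show "(lterm k0 k X p, 0) \<in> ?J" if "X \<in> G k0 k" "p \<in> I'"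
    by (rule module.span_base[OF m]) (use that in blast)
  show "(0, p) \<in> ?J" if "p \<in> I'"
    by (rule module.span_base[OF m]) (use that in blast)
qed

text \<open>The right-hand side is a subspace containing the generators. It gives both facts that
  the quotient requires: the ideal lies in the carrier, and evaluation kills it.\<close>

lemma J_subset:
  "J \<subseteq> {x. fst x \<in> loop_carrier \<and> snd x \<in> laurent_sub m \<and>
    (\<forall>\<iota>\<in>multi_indices Ns. eval_loop \<iota> (fst x) = 0 \<and> laurent_eval a \<iota> (snd x) = 0)}" (is "_ \<subseteq> ?K")
  unfolding loop_ideal_def
proof (rule module.span_minimal[OF module_loop_scale])
  show "module.subspace (loop_scale sc) ?K"
    unfolding module.subspace_def[OF module_loop_scale]
    by (auto simp: loop_scale_eq loop_carrier_simps laurent_sub_simps eval_loop_simps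
        laurent_eval_simps eval_loop_scale laurent_eval_scale mult_map_scale_conv_mult Gam_def)
       (auto simp: mult_map_scale_conv_mult[symmetric] laurent_eval_scale additive.zero[OF additive_map_sc])
qed (auto simp: loop_term_eq point_ideal_eq_vanishing lterm_carrier eval_loop_lterm
    loop_carrier_simps laurent_sub_simps eval_loop_simps laurent_eval_simps)

text \<open>A canonical representative modulo \<open>Gam m\<close>: it labels the class of k and
  splits off from t^k a monomial of A(m).\<close>

definition residue :: "int ^ 'n \<Rightarrow> int ^ 'n" where
  "residue k = (\<chi> i. k $ i mod int (m i))"

lemma residue_Gam: "k - residue k \<in> Gam m"
  by (simp add: Gam_def residue_def minus_mod_eq_mult_div)

lemma residue_eq_iff: "residue k = residue l \<longleftrightarrow> k - residue l \<in> Gam m"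
  by (simp add: Gam_def residue_def vec_eq_iff mod_eq_dvd_iff[symmetric])

lemma lookup_eval_loop:
  "Poly_Mapping.lookup (eval_loop \<iota> f) k0 =
    (\<Sum>k\<in>{k. (k0, k) \<in> Poly_Mapping.keys f}. sc (point_pow a \<iota> k) (Poly_Mapping.lookup f (k0, k)))"
proof -
  have "Poly_Mapping.lookup (eval_loop \<iota> f) k0 =
      (\<Sum>p\<in>Poly_Mapping.keys f. if fst p = k0 then sc (point_pow a \<iota> (snd p)) (Poly_Mapping.lookup f p) else 0)"
    by (simp add: eval_loop_def psum_def lookup_sum lookup_single when_def)
  also have "\<dots> = (\<Sum>p\<in>{p \<in> Poly_Mapping.keys f. fst p = k0}.
      sc (point_pow a \<iota> (snd p)) (Poly_Mapping.lookup f p))"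
    by (simp add: sum.inter_filter)
  also have "\<dots> = (\<Sum>k\<in>{k. (k0, k) \<in> Poly_Mapping.keys f}.
      sc (point_pow a \<iota> k) (Poly_Mapping.lookup f (k0, k)))"
    by (rule sum.reindex_bij_witness[of _ "\<lambda>k. (k0, k)" snd]) auto
  finally show ?thesis .
qed

text \<open>Independence is applied to the coefficient of degree \<open>k0\<close>. The index set
  consists of pairs in order to match the fibres along which the support of f is grouped
  afterwards.\<close>

lemma eval_loop_zero_residue:
  assumes f: "f \<in> loop_carrier" and zero: "eval_loop \<iota> f = 0"
  shows "(\<Sum>p\<in>{p \<in> Poly_Mapping.keys f. fst p = k0 \<and> residue (snd p) = residue r}.
    sc (point_pow a \<iota> (snd p)) (Poly_Mapping.lookup f p)) = 0"
proof -
  let ?Q = "{k. (k0, k) \<in> Poly_Mapping.keys f}"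
  let ?Y = "\<lambda>k. sc (point_pow a \<iota> k) (Poly_Mapping.lookup f (k0, k))"
  have "finite ?Q" by (rule finite_subset[of _ "snd ` Poly_Mapping.keys f"]) force+
  moreover have "?Y k \<in> G k0 k" for k
    using f G_subspace by (auto simp: loop_carrier_def subspace_scale)
  moreover have "(\<Sum>k\<in>?Q. ?Y k) = 0" by (simp add: lookup_eval_loop[symmetric] zero)
  ultimately have "(\<Sum>k\<in>{k \<in> ?Q. k - residue r \<in> Gam m}. ?Y k) = 0"
    by (rule G_independent)
  also have "(\<Sum>k\<in>{k \<in> ?Q. k - residue r \<in> Gam m}. ?Y k) =
    (\<Sum>p\<in>{p \<in> Poly_Mapping.keys f. fst p = k0 \<and> residue (snd p) = residue r}.
      sc (point_pow a \<iota> (snd p)) (Poly_Mapping.lookup f p))"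
    by (rule sum.reindex_bij_witness[of _ snd "\<lambda>k. (k0, k)"]) (auto simp: residue_eq_iff)
  finally show ?thesis .
qed

lemma kernel_in_J:
  assumes f: "f \<in> loop_carrier" and zero: "\<And>\<iota>. \<iota> \<in> multi_indices Ns \<Longrightarrow> eval_loop \<iota> f = 0"
  shows "(f, 0) \<in> J"
proof -
  \<comment> \<open>The share of the grid point \<iota> in the interpolation of the term of f at p;
    the scalar is the value at \<iota> of the monomial split off by \<open>residue\<close>.\<close>
  define D where "D \<iota> p = lterm (fst p) (residue (snd p)) (Poly_Mapping.lookup f p)
      (Poly_Mapping.single 0 (point_pow a \<iota> (snd p - residue (snd p))) * idem \<iota>)" for \<iota> p
  have "(Poly_Mapping.single p (Poly_Mapping.lookup f p) - (\<Sum>\<iota>\<in>multi_indices Ns. D \<iota> p), 0) \<in> J" for p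
  proof -
    obtain k0 k where p: "p = (k0, k)" by (cases p)
    let ?X = "Poly_Mapping.lookup f p"
    have "?X \<in> G k0 (residue k)"
      using f G_cong[OF residue_Gam] by (auto simp: loop_carrier_def p)
    from J_lterm[OF this interpolation_monomial[OF residue_Gam[of k], of 1]]
    show ?thesis
      by (simp add: Modules.additive.diff[OF additive_lterm(1)] Modules.additive.sum[OF additive_lterm(1)]
          lterm_single D_def p)
  qed
  then have "(\<Sum>p\<in>Poly_Mapping.keys f.
      (Poly_Mapping.single p (Poly_Mapping.lookup f p) - (\<Sum>\<iota>\<in>multi_indices Ns. D \<iota> p), 0)) \<in> J"
    by (intro J_sum)
  also have "(\<Sum>p\<in>Poly_Mapping.keys f.
      (Poly_Mapping.single p (Poly_Mapping.lookup f p) - (\<Sum>\<iota>\<in>multi_indices Ns. D \<iota> p), 0)) =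
    (f - (\<Sum>\<iota>\<in>multi_indices Ns. \<Sum>p\<in>Poly_Mapping.keys f. D \<iota> p), 0 :: (int ^ 'n) \<Rightarrow>\<^sub>0 complex)"
    by (subst sum.swap) (simp add: prod_eq_iff fst_sum snd_sum sum_subtractf poly_mapping_expand)
  finally have mem: "(f - (\<Sum>\<iota>\<in>multi_indices Ns. \<Sum>p\<in>Poly_Mapping.keys f. D \<iota> p), 0) \<in> J" .
  have "(\<Sum>p\<in>Poly_Mapping.keys f. D \<iota> p) = 0" if \<iota>: "\<iota> \<in> multi_indices Ns" for \<iota>
  proof -
    \<comment> \<open>Apart from scalar and coefficient, \<open>D \<iota> p\<close> depends on p
      only through \<open>?h p\<close>, so along a fibre the sum moves into the Lie algebra.\<close>
    let ?h = "\<lambda>p. (fst p, residue (snd p))"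
    have "(\<Sum>p\<in>{p \<in> Poly_Mapping.keys f. ?h p = ?h q}. D \<iota> p) = 0" for q
    proof -
      let ?P = "{p \<in> Poly_Mapping.keys f. fst p = fst q \<and> residue (snd p) = residue (snd q)}"
      \<comment> \<open>This factor is constant on the fibre; pulling it out leaves the weights that
        occur in \<open>eval_loop_zero_residue\<close>.\<close>
      let ?c = "point_pow a \<iota> (- residue (snd q))"
      have "(\<Sum>p\<in>?P. D \<iota> p) = (\<Sum>p\<in>?P. lterm (fst q) (residue (snd q))
          (sc ?c (sc (point_pow a \<iota> (snd p)) (Poly_Mapping.lookup f p))) (idem \<iota>))"
      proof (rule sum.cong)
        fix p assume p: "p \<in> ?P"
        have "point_pow a \<iota> (snd p - residue (snd q)) = ?c * point_pow a \<iota> (snd p)"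
          using point_pow_add[OF \<iota>, of "- residue (snd q)" "snd p"] by simp
        with p show "D \<iota> p = lterm (fst q) (residue (snd q))
            (sc ?c (sc (point_pow a \<iota> (snd p)) (Poly_Mapping.lookup f p))) (idem \<iota>)"
          by (simp add: D_def lterm_scale)
      qed simp
      also have "\<dots> = lterm (fst q) (residue (snd q))
          (sc ?c (\<Sum>p\<in>?P. sc (point_pow a \<iota> (snd p)) (Poly_Mapping.lookup f p))) (idem \<iota>)"
        by (simp only: scale_sum_right Modules.additive.sum[OF additive_lterm(2)])
      also have "\<dots> = 0"
        by (simp add: eval_loop_zero_residue[OF f zero[OF \<iota>]] Modules.additive.zero[OF additive_lterm(2)])
      finally show ?thesis by simp
    qed
    note fibre = this
    have "(\<Sum>p\<in>Poly_Mapping.keys f. D \<iota> p) =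
        (\<Sum>y\<in>?h ` Poly_Mapping.keys f. \<Sum>p\<in>{p \<in> Poly_Mapping.keys f. ?h p = y}. D \<iota> p)"
      by (rule sum.image_gen) simp
    also have "\<dots> = 0"
    proof (rule sum.neutral, rule ballI)
      fix y assume "y \<in> ?h ` Poly_Mapping.keys f"
      then obtain q where "y = ?h q" by blast
      then show "(\<Sum>p\<in>{p \<in> Poly_Mapping.keys f. ?h p = y}. D \<iota> p) = 0"
        by (simp only: fibre)
    qed
    finally show ?thesis .
  qed
  then have "(\<Sum>\<iota>\<in>multi_indices Ns. \<Sum>p\<in>Poly_Mapping.keys f. D \<iota> p) = 0" by simp
  with mem show ?thesis by simp
qed

lemma kernel:
  assumes "fst x \<in> loop_carrier" "snd x \<in> laurent_sub m"
    and "\<And>\<iota>. \<iota> \<in> multi_indices Ns \<Longrightarrow> eval_loop \<iota> (fst x) = 0 \<and> laurent_eval a \<iota> (snd x) = 0"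
  shows "x \<in> J"
proof -
  have "(fst x, 0) \<in> J" using assms by (intro kernel_in_J) auto
  moreover have "(0, snd x) \<in> J"
    using assms by (intro J_central) (auto simp: point_ideal_eq_vanishing)
  ultimately have "(fst x, 0) + (0, snd x) \<in> J" by (rule J_add)
  then show ?thesis by simp
qed

section \<open>Surjectivity of evaluation\<close>

lemma eval_loop_onto_single:
  assumes \<iota>: "\<iota> \<in> multi_indices Ns" and X: "X \<in> E k0"
  shows "\<exists>f\<in>loop_carrier. \<forall>\<kappa>\<in>multi_indices Ns.
    eval_loop \<kappa> f = (if \<kappa> = \<iota> then Poly_Mapping.single k0 X else 0)"
proof -
  \<comment> \<open>The vectors attainable at \<iota> alone form a subspace, so
    \<open>E_span\<close> reduces the claim to joint eigenvectors.\<close>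
  define T where "T = {X. \<exists>f\<in>loop_carrier. \<forall>\<kappa>\<in>multi_indices Ns.
    eval_loop \<kappa> f = (if \<kappa> = \<iota> then Poly_Mapping.single k0 X else 0)}"
  have "subspace T"
  proof (rule subspaceI)
    show "0 \<in> T"
      unfolding T_def by (auto intro!: bexI[of _ 0] loop_carrier_simps simp: eval_loop_simps)
    fix x y assume "x \<in> T" "y \<in> T"
    then obtain f g where "f \<in> loop_carrier" "\<forall>\<kappa>\<in>multi_indices Ns.
        eval_loop \<kappa> f = (if \<kappa> = \<iota> then Poly_Mapping.single k0 x else 0)"
      "g \<in> loop_carrier" "\<forall>\<kappa>\<in>multi_indices Ns.
        eval_loop \<kappa> g = (if \<kappa> = \<iota> then Poly_Mapping.single k0 y else 0)"
      unfolding T_def by blast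
    then show "x + y \<in> T"
      unfolding T_def
      by (auto intro!: bexI[of _ "f + g"] loop_carrier_simps simp: eval_loop_simps single_add)
  next
    fix c x assume "x \<in> T"
    then obtain f where "f \<in> loop_carrier" "\<forall>\<kappa>\<in>multi_indices Ns.
        eval_loop \<kappa> f = (if \<kappa> = \<iota> then Poly_Mapping.single k0 x else 0)"
      unfolding T_def by blast
    then show "sc c x \<in> T"
      unfolding T_def
      by (auto intro!: bexI[of _ "Poly_Mapping.map (sc c) f"] loop_carrier_simps
          simp: eval_loop_scale map_sc_single Modules.additive.zero[OF additive_map_sc])
  qed
  moreover have "X \<in> T" if "X \<in> G k0 k" for X k
    unfolding T_def
  proof (intro CollectI bexI ballI)
    \<comment> \<open>\<open>idem \<iota>\<close> isolates the grid point, and the scalar cancels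
      the value of t^k there.\<close>
    let ?p = "Poly_Mapping.single 0 (point_pow a \<iota> (- k)) * idem \<iota>"
    show "lterm k0 k X ?p \<in> loop_carrier"
      using that by (intro lterm_carrier laurent_sub_simps idem_in) (auto simp: Gam_def)
    fix \<kappa> assume \<kappa>: "\<kappa> \<in> multi_indices Ns"
    show "eval_loop \<kappa> (lterm k0 k X ?p) = (if \<kappa> = \<iota> then Poly_Mapping.single k0 X else 0)"
      using \<kappa> \<iota> by (simp add: eval_loop_lterm laurent_eval_mult laurent_eval_single laurent_eval_idem
          point_pow_uminus point_pow_nonzero)
  qed
  ultimately have "span (\<Union>k. G k0 k) \<subseteq> T" by (intro span_minimal) auto
  then show ?thesis using X E_span unfolding T_def by blast
qed

lemma eval_onto:
  assumes \<iota>: "\<iota> \<in> multi_indices Ns" and y: "\<And>k0. Poly_Mapping.lookup (fst y) k0 \<in> E k0"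
  shows "\<exists>x. fst x \<in> loop_carrier \<and> snd x \<in> laurent_sub m \<and> (\<forall>\<kappa>\<in>multi_indices Ns.
    (eval_loop \<kappa> (fst x), laurent_eval a \<kappa> (snd x)) = (if \<kappa> = \<iota> then y else 0))"
proof -
  obtain g c where gc: "y = (g, c)" by (cases y)
  have "\<forall>k0. \<exists>f\<in>loop_carrier. \<forall>\<kappa>\<in>multi_indices Ns.
      eval_loop \<kappa> f = (if \<kappa> = \<iota> then Poly_Mapping.single k0 (Poly_Mapping.lookup g k0) else 0)"
    using eval_loop_onto_single[OF \<iota>] y by (simp add: gc)
  then obtain F where F: "\<And>k0. F k0 \<in> loop_carrier" "\<And>k0 \<kappa>. \<kappa> \<in> multi_indices Ns \<Longrightarrow>
      eval_loop \<kappa> (F k0) = (if \<kappa> = \<iota> then Poly_Mapping.single k0 (Poly_Mapping.lookup g k0) else 0)"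
    by metis
  let ?x = "(\<Sum>k0\<in>Poly_Mapping.keys g. F k0, Poly_Mapping.single 0 c * idem \<iota>)"
  have "fst ?x \<in> loop_carrier" using F by (auto intro: loop_carrier_sum)
  moreover have "snd ?x \<in> laurent_sub m"
    by (auto intro!: laurent_sub_simps idem_in simp: Gam_def)
  moreover have "(eval_loop \<kappa> (fst ?x), laurent_eval a \<kappa> (snd ?x)) = (if \<kappa> = \<iota> then y else 0)"
    if "\<kappa> \<in> multi_indices Ns" for \<kappa>
    using that \<iota> by (simp add: gc eval_loop_simps F poly_mapping_expand laurent_eval_mult
        laurent_eval_single laurent_eval_idem zero_prod_def)
  ultimately show ?thesis by blast
qed

lemma eval_carrier:
  assumes "f \<in> loop_carrier"
  shows "Poly_Mapping.lookup (eval_loop \<iota> f) k0 \<in> E k0"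
  unfolding lookup_eval_loop
  using assms
  by (intro subspace_sum subspace_scale E_subspace subsetD[OF G_subset_E]) (auto simp: loop_carrier_def)

end

theorem lemma5p2:
  fixes sc :: "complex \<Rightarrow> 'g::ab_group_add \<Rightarrow> 'g"
    and br :: "'g \<Rightarrow> 'g \<Rightarrow> 'g"
    and B :: "'g \<Rightarrow> 'g \<Rightarrow> complex"
    and \<sigma>0 :: "'g \<Rightarrow> 'g" and \<sigma> :: "'n::finite \<Rightarrow> 'g \<Rightarrow> 'g"
    and m0 :: nat and m :: "'n \<Rightarrow> nat"
    and \<xi>0 :: complex and \<xi> :: "'n \<Rightarrow> complex"
    and G :: "int \<Rightarrow> int ^ 'n \<Rightarrow> 'g set"
    and H :: "'g set" and R :: "('g \<Rightarrow> complex) set"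
    and Ns :: "'n \<Rightarrow> nat" and N :: nat and a :: "'n \<Rightarrow> nat \<Rightarrow> complex"
    and I :: "nat \<Rightarrow> 'n \<Rightarrow> nat"
    and L :: "('g, 'n) loop_elt lie_alg" and M :: "(nat \<Rightarrow> 'g affine_elt) lie_alg"
    and \<phi> :: "('g, 'n) loop_elt \<Rightarrow> nat \<Rightarrow> 'g affine_elt"
  assumes "complex_lie_algebra sc br" and "finite_dim sc" and "simple_lie sc br UNIV"
    and "invariant_form sc br B" and "nondegenerate B"
    and "lie_automorphism sc br \<sigma>0" and "\<And>i. lie_automorphism sc br (\<sigma> i)"
    and "\<And>i. \<sigma>0 \<circ> \<sigma> i = \<sigma> i \<circ> \<sigma>0" and "\<And>i j. \<sigma> i \<circ> \<sigma> j = \<sigma> j \<circ> \<sigma> i"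
    and "has_order \<sigma>0 m0" and "\<And>i. has_order (\<sigma> i) (m i)"
    and "primitive_root m0 \<xi>0" and "\<And>i. primitive_root (m i) (\<xi> i)"
    and "G = joint_eigenspace sc \<sigma>0 \<sigma> \<xi>0 \<xi>"
    and "lie_torus sc br G H R"
    and "\<And>i. 1 \<le> Ns i" and "N = (\<Prod>i\<in>UNIV. Ns i)"
    and "\<And>i j. 1 \<le> j \<Longrightarrow> j \<le> Ns i \<Longrightarrow> a i j \<noteq> 0"
    and "\<And>i j j'. 1 \<le> j \<Longrightarrow> j \<le> Ns i \<Longrightarrow> 1 \<le> j' \<Longrightarrow> j' \<le> Ns i \<Longrightarrow> j \<noteq> j' \<Longrightarrow>
               a i j ^ m i \<noteq> a i j' ^ m i"
    and "bij_betw I {1..N} (multi_indices Ns)"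
    and "L = loop_alg sc br B G m"
    and "M = lie_copies N (affine_alg sc br B (eigenspace sc \<sigma>0 \<xi>0))"
    and "\<phi> = ev_map sc a N I"
  shows "lie_hom L M \<phi> \<and>
     \<phi> ` Carrier L = Carrier M \<and>
     lie_isomorphic (lie_quotient L (loop_ideal sc G (point_ideal m a Ns))) M \<and>
     (\<forall>d. \<forall>x \<in> Carrier L \<inter> loop_degree d. \<forall>j\<in>{1..N}. \<phi> x j \<in> affine_degree d)"
proof -
  interpret multiloop sc br m a Ns B \<sigma>0 \<sigma> \<xi>0 \<xi>
  proof (intro multiloop.intro point_grid.intro multiloop_axioms.intro)
    show "Vector_Spaces.linear sc sc \<sigma>0" "Vector_Spaces.linear sc sc (\<sigma> i)" for i
      using assms(6,7) by (auto simp: lie_automorphism_def)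
    show "0 < m i" "\<sigma> i ^^ m i = id" for i
      using assms(11)[of i] by (auto simp: has_order_def)
  qed (fact assms)+
  note G_eq = assms(14) and bij = assms(20) and L_eq = assms(21) and M_eq = assms(22)
  have I_mem: "I j \<in> multi_indices Ns" if "j \<in> {1..N}" for j
    using bij that by (rule bij_betwE[THEN bspec])
  have I_inj: "I i = I j \<longleftrightarrow> i = j" if "i \<in> {1..N}" "j \<in> {1..N}" for i j
    using bij_betw_imp_inj_on[OF bij] that by (rule inj_on_eq_iff)
  have I_surj: "\<exists>j\<in>{1..N}. \<iota> = I j" if "\<iota> \<in> multi_indices Ns" for \<iota>
    using that bij_betw_imp_surj_on[OF bij] by blast
  have \<phi>_eq: "\<phi> x = (\<lambda>j\<in>{1..N}. (eval_loop (I j) (fst x), laurent_eval a (I j) (snd x)))" for x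
    unfolding assms(23) by (rule ev_map_eq)
  have L_carrier: "x \<in> Carrier L \<longleftrightarrow> fst x \<in> loop_carrier \<and> snd x \<in> laurent_sub m" for x
    by (cases x) (auto simp: L_eq loop_alg_def loop_carrier_def G_eq)
  have L_ops: "Plus L = (+)" "Scale L = loop_scale sc" "Bracket L = loop_bracket br B"
    by (simp_all add: L_eq loop_alg_def)
  have M_carrier: "Carrier M = {1..N} \<rightarrow>\<^sub>E {y. \<forall>k0. Poly_Mapping.lookup (fst y) k0 \<in> eigenspace sc \<sigma>0 \<xi>0 k0}"
    by (auto simp: M_eq lie_copies_def affine_alg_def split_def)
  have M_ops: "Plus M x y = (\<lambda>j\<in>{1..N}. x j + y j)"
    "Scale M c x = (\<lambda>j\<in>{1..N}. (Poly_Mapping.map (sc c) (fst (x j)), c * snd (x j)))"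
    "Bracket M x y = (\<lambda>j\<in>{1..N}. affine_bracket br B (x j) (y j))" for x y c
    by (simp_all add: M_eq lie_copies_def affine_alg_def split_def)
  have hom: "lie_hom L M \<phi>"
    unfolding lie_hom_def
  proof (intro conjI ballI allI)
    show "\<phi> \<in> Carrier L \<rightarrow> Carrier M"
      by (auto simp: M_carrier \<phi>_eq L_carrier eval_carrier)
    fix x y
    show "\<phi> (Plus L x y) = Plus M (\<phi> x) (\<phi> y)"
      by (auto simp: L_ops M_ops \<phi>_eq eval_loop_simps laurent_eval_simps)
    show "\<phi> (Scale L c x) = Scale M c (\<phi> x)" for c
      by (auto simp: L_ops M_ops \<phi>_eq loop_scale_eq eval_loop_scale laurent_eval_scale)
    show "\<phi> (Bracket L x y) = Bracket M (\<phi> x) (\<phi> y)"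
      by (auto simp: L_ops M_ops \<phi>_eq loop_bracket_eq affine_bracket_eq eval_loop_br1
          laurent_eval_br2 I_mem)
  qed
  have surj: "\<phi> ` Carrier L = Carrier M"
  proof
    show "\<phi> ` Carrier L \<subseteq> Carrier M" using hom by (auto simp: lie_hom_def)
    show "Carrier M \<subseteq> \<phi> ` Carrier L"
    proof
      fix y assume y: "y \<in> Carrier M"
      have "\<forall>i\<in>{1..N}. \<exists>x. fst x \<in> loop_carrier \<and> snd x \<in> laurent_sub m \<and> (\<forall>\<kappa>\<in>multi_indices Ns.
          (eval_loop \<kappa> (fst x), laurent_eval a \<kappa> (snd x)) = (if \<kappa> = I i then y i else 0))"
        using y by (intro ballI eval_onto I_mem) (auto simp: M_carrier)
      then obtain X where X: "\<And>i. i \<in> {1..N} \<Longrightarrow> fst (X i) \<in> loop_carrier \<and> snd (X i) \<in> laurent_sub m"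
        and eval_X: "\<And>i \<kappa>. i \<in> {1..N} \<Longrightarrow> \<kappa> \<in> multi_indices Ns \<Longrightarrow>
          (eval_loop \<kappa> (fst (X i)), laurent_eval a \<kappa> (snd (X i))) = (if \<kappa> = I i then y i else 0)"
        by metis
      \<comment> \<open>Each \<open>X i\<close> evaluates to \<open>y i\<close> in copy i and to 0
        in the others.\<close>
      let ?x = "\<Sum>i\<in>{1..N}. X i"
      have "?x \<in> Carrier L"
        using X by (auto simp: L_carrier fst_sum snd_sum intro!: loop_carrier_sum laurent_sub_sum)
      moreover have "\<phi> ?x = y"
      proof (rule PiE_ext[OF _ y[unfolded M_carrier]])
        show "\<phi> ?x \<in> {1..N} \<rightarrow>\<^sub>E {y. \<forall>k0. Poly_Mapping.lookup (fst y) k0 \<in> eigenspace sc \<sigma>0 \<xi>0 k0}"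
          using \<open>\<phi> ` Carrier L \<subseteq> Carrier M\<close> calculation unfolding M_carrier by blast
        fix j assume j: "j \<in> {1..N}"
        then have "\<phi> ?x j = (\<Sum>i\<in>{1..N}. (eval_loop (I j) (fst (X i)), laurent_eval a (I j) (snd (X i))))"
          by (simp add: \<phi>_eq fst_sum snd_sum eval_loop_simps laurent_eval_simps prod_eq_iff)
        also have "\<dots> = (\<Sum>i\<in>{1..N}. if i = j then y i else 0)"
          using j by (intro sum.cong refl) (auto simp: eval_X I_mem I_inj)
        also have "\<dots> = y j" using j by simp
        finally show "\<phi> ?x j = y j" .
      qed
      ultimately show "y \<in> \<phi> ` Carrier L" by blast
    qed
  qed
  have iso: "lie_isomorphic (lie_quotient L (loop_ideal sc G (point_ideal m a Ns))) M"
    unfolding G_eq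
  proof (rule lie_isomorphic_quotient[OF hom surj L_ops(1) _ J_0 J_add])
    show "x + z \<in> Carrier L" if "x \<in> Carrier L" "z \<in> J" for x z
      using that J_subset by (auto simp: L_carrier loop_carrier_simps laurent_sub_simps)
    show "\<phi> (x + z) = \<phi> x" if "z \<in> J" for x z
    proof -
      have "eval_loop (I j) (fst z) = 0 \<and> laurent_eval a (I j) (snd z) = 0" if "j \<in> {1..N}" for j
        using J_subset \<open>z \<in> J\<close> I_mem[OF that] by blast
      then show ?thesis by (auto simp: \<phi>_eq eval_loop_simps laurent_eval_simps)
    qed
    show "x - y \<in> J" if "x \<in> Carrier L" "y \<in> Carrier L" "\<phi> x = \<phi> y" for x y
    proof (rule kernel)
      fix \<iota> assume "\<iota> \<in> multi_indices Ns"
      \<comment> \<open>Agreement in all N copies is agreement at every grid point, as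
        \<open>I\<close> reaches every multi-index.\<close>
      then obtain j where j: "j \<in> {1..N}" "\<iota> = I j" using I_surj by blast
      have "\<phi> x j = \<phi> y j" using that by simp
      with j show "eval_loop \<iota> (fst (x - y)) = 0 \<and> laurent_eval a \<iota> (snd (x - y)) = 0"
        by (simp add: \<phi>_eq eval_loop_simps laurent_eval_simps)
    qed (use that in \<open>auto simp: L_carrier loop_carrier_simps laurent_sub_simps\<close>)
  qed
  have "\<phi> x j \<in> affine_degree d" if x: "x \<in> loop_degree d" and j: "j \<in> {1..N}" for d x j
  proof -
    have "k0 = d" if "(k0, k) \<in> Poly_Mapping.keys (fst x)" for k0 k
      using x that by (cases x) (simp add: loop_degree_def, blast)
    \<comment> \<open>The coefficient at \<open>k0\<close> collects only terms of f of the same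
      t_0-degree, and for \<open>k0 \<noteq> d\<close> there are none.\<close>
    then have "Poly_Mapping.lookup (eval_loop (I j) (fst x)) k0 = 0" if "k0 \<noteq> d" for k0
      using that unfolding lookup_eval_loop by (intro sum.neutral) auto
    moreover have "laurent_eval a (I j) (snd x) = 0" if "d \<noteq> 0"
      using x that by (auto simp: loop_degree_def laurent_eval_simps)
    ultimately show ?thesis
      using j by (auto simp: \<phi>_eq affine_degree_def in_keys_iff)
  qed
  with hom surj iso show ?thesis by blast
qed

end
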